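(* Let $B$ be a semi-Boolean restriction semigroup with projections $P$. Then the map $b\mapsto O_b=\{U\in\mathcal U(B):b\in U\}$ is an isomorphism of $B$ onto a restriction semigroup formed from a basis of compact open sections of the ultrafilter semicategory $\mathcal U(B)$ (with the setwise product of sections, and with projections contained in the compact open subsets of $\mathcal U(B)^0$).
   Context: **Restriction semigroups.** Let $B$ be a semigroup with a distinguished commutative subsemigroup $P$ of idempotents ("projections"). Write $a\leq b$ iff $a=bp$ for some $p\in P$; $\mathsf s(a)=\min\{p\in P:ap=a\}$ if it exists. $B$ is a restriction semigroup relative to $P$ if every element has a source projection $\mathsf s(a)$ (then $\leq$ is a partial order), $\mathsf s(ab)=\mathsf s(\mathsf s(a)b)$ for all $a,b\in B$, and $pb\leq b$ for all $p\in P$, $b\in B$. An isomorphism of restriction semigroups is a bijective multiplicative map that preserves source projections (hence the order and the projections). **Semi-Boolean.** A poset is a semi-Boolean algebra if every pair of elements has a meet and every principal ideal $\{c:c\leq b\}$ is a Boolean algebra. A semi-Boolean restriction semigroup is a restriction semigroup $B$ with an element $0\in P$ satisfying $0b=0$ for all $b\in B$ (then $0$ is also a right zero and the minimum of $B$), such that $(B,\leq)$ is a semi-Boolean algebra and $(a\vee b)c=ac\vee bc$ for all $a,b,c\in B$ with $a,b$ having an upper bound. **Ultrafilter semicategory.** A filter in the poset $B$ is a non-empty up-set $F$ such that any $a,b\in F$ have a common lower bound in $F$; it is proper if $F\neq B$; an ultrafilter is a maximal proper filter. $\mathcal U(B)$ is the set of ultrafilters with the topology having basis $(O_b)_{b\in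 B}$. The partial product is $V\cdot W=\{c\in B:\exists v\in V,w\in W,\ vw\leq c\}$, defined precisely when $0\notin VW=\{vw:v\in V,w\in W\}$; this makes $\mathcal U(B)$ a Hausdorff ample semicategory. Its unit set is $\mathcal U(B)^0=\{U\in\mathcal U(B): U\cap P\neq\emptyset\}$, and the source unit of $U$ is $\mathsf s(U)=\{c\in B:\exists u\in U,\ \mathsf s(u)\leq c\}$. **Sections.** A section of $\mathcal U(B)$ is a subset on which the source map $U\mapsto\mathsf s(U)$ is injective. The product of subsets $O,N\subseteq\mathcal U(B)$ is $ON=\{V\cdot W: V\in O,\ W\in N,\ V\cdot W\text{ defined}\}$; under this product the compact open sections of $\mathcal U(B)$ form a restriction semigroup relative to the compact open subsets of $\mathcal U(B)^0$, with order given by inclusion and source projection of $O$ equal to $\mathsf s[O]$. *)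

theory Defs
  imports "HOL-Algebra.Lattice" "HOL-Analysis.Abstract_Topology"
begin

section \<open>Restriction semigroups\<close>

record 'a psemigroup = "'a partial_object" +
  mult :: "'a \<Rightarrow> 'a \<Rightarrow> 'a" (infixl "\<otimes>\<index>" 70)
  proj :: "'a set"

definition rs_order :: "('a, 'm) psemigroup_scheme \<Rightarrow> 'a gorder" where
  "rs_order B = \<lparr>carrier = carrier B, eq = (=), le = (\<lambda>a b. \<exists>p\<in>proj B. a = b \<otimes>\<^bsub>B\<^esub> p)\<rparr>"

abbreviation rs_le :: "('a, 'm) psemigroup_scheme \<Rightarrow> 'a \<Rightarrow> 'a \<Rightarrow> bool" where
  "rs_le B \<equiv> le (rs_order B)"

text \<open>The order is antisymmetric on the projections, as these form a semilattice, so there is at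
  most one source projection.\<close>

definition is_source :: "('a, 'm) psemigroup_scheme \<Rightarrow> 'a \<Rightarrow> 'a \<Rightarrow> bool" where
  "is_source B a s \<longleftrightarrow> least (rs_order B) s {p \<in> proj B. a \<otimes>\<^bsub>B\<^esub> p = a}"

definition source :: "('a, 'm) psemigroup_scheme \<Rightarrow> 'a \<Rightarrow> 'a" where
  "source B a = (THE s. is_source B a s)"

locale restriction_semigroup =
  fixes B :: "('a, 'm) psemigroup_scheme" (structure)
  assumes mult_closed: "\<lbrakk>a \<in> carrier B; b \<in> carrier B\<rbrakk> \<Longrightarrow> a \<otimes> b \<in> carrier B"
    and mult_assoc: "\<lbrakk>a \<in> carrier B; b \<in> carrier B; c \<in> carrier B\<rbrakk> \<Longrightarrow> a \<otimes> b \<otimes> c = a \<otimes> (b \<otimes> c)"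
    and proj_subset: "proj B \<subseteq> carrier B"
    and proj_closed: "\<lbrakk>p \<in> proj B; q \<in> proj B\<rbrakk> \<Longrightarrow> p \<otimes> q \<in> proj B"
    and proj_comm: "\<lbrakk>p \<in> proj B; q \<in> proj B\<rbrakk> \<Longrightarrow> p \<otimes> q = q \<otimes> p"
    and proj_idem: "p \<in> proj B \<Longrightarrow> p \<otimes> p = p"
    and source_exists: "a \<in> carrier B \<Longrightarrow> \<exists>s. is_source B a s"
    and source_mult: "\<lbrakk>a \<in> carrier B; b \<in> carrier B\<rbrakk> \<Longrightarrow> source B (a \<otimes> b) = source B (source B a \<otimes> b)"
    and proj_mult_le: "\<lbrakk>p \<in> proj B; b \<in> carrier B\<rbrakk> \<Longrightarrow> rs_le B (p \<otimes> b) b"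

definition restriction_iso ::
    "('a, 'm) psemigroup_scheme \<Rightarrow> ('b, 'n) psemigroup_scheme \<Rightarrow> ('a \<Rightarrow> 'b) \<Rightarrow> bool" where
  "restriction_iso B C f \<longleftrightarrow>
     bij_betw f (carrier B) (carrier C) \<and>
     (\<forall>a\<in>carrier B. \<forall>b\<in>carrier B. f (a \<otimes>\<^bsub>B\<^esub> b) = f a \<otimes>\<^bsub>C\<^esub> f b) \<and>
     (\<forall>a\<in>carrier B. f (source B a) = source C (f a))"


section \<open>Semi-Boolean restriction semigroups\<close>

definition boolean_lattice :: "('a, 'm) gorder_scheme \<Rightarrow> bool" where
  "boolean_lattice L \<longleftrightarrow>
     bounded_lattice L \<and>
     (\<forall>x\<in>carrier L. \<forall>y\<in>carrier L. \<forall>z\<in>carrier L.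
        x \<sqinter>\<^bsub>L\<^esub> (y \<squnion>\<^bsub>L\<^esub> z) = (x \<sqinter>\<^bsub>L\<^esub> y) \<squnion>\<^bsub>L\<^esub> (x \<sqinter>\<^bsub>L\<^esub> z)) \<and>
     (\<forall>x\<in>carrier L. \<exists>y\<in>carrier L. x \<sqinter>\<^bsub>L\<^esub> y = \<bottom>\<^bsub>L\<^esub> \<and> x \<squnion>\<^bsub>L\<^esub> y = \<top>\<^bsub>L\<^esub>)"

definition semi_boolean_algebra :: "('a, 'm) gorder_scheme \<Rightarrow> bool" where
  "semi_boolean_algebra L \<longleftrightarrow>
     lower_semilattice L \<and>
     (\<forall>b\<in>carrier L. boolean_lattice (L\<lparr>carrier := {c \<in> carrier L. c \<sqsubseteq>\<^bsub>L\<^esub> b}\<rparr>))"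

record 'a zpsemigroup = "'a psemigroup" +
  zero :: 'a ("\<zero>\<index>")

text \<open>In \<open>join_mult\<close> all joins are taken in the whole poset. They exist: \<open>a\<close> and \<open>b\<close> have a join in
  the principal ideal of any common upper bound \<open>d\<close>, which is a join in the whole poset because of
  binary meets; \<open>a \<otimes> c\<close> and \<open>b \<otimes> c\<close> have the upper bound \<open>d \<otimes> c\<close>.\<close>

locale semi_boolean_restriction_semigroup = restriction_semigroup B
  for B :: "('a, 'm) zpsemigroup_scheme" (structure) +
  assumes zero_proj: "\<zero> \<in> proj B"
    and zero_mult: "b \<in> carrier B \<Longrightarrow> \<zero> \<otimes> b = \<zero>"
    and semi_boolean: "semi_boolean_algebra (rs_order B)"
    and join_mult:
      "\<lbrakk>a \<in> carrier B; b \<in> carrier B; c \<in> carrier B; \<exists>d\<in>carrier B. rs_le B a d \<and> rs_le B b d\<rbrakk>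
       \<Longrightarrow> (a \<squnion>\<^bsub>rs_order B\<^esub> b) \<otimes> c = (a \<otimes> c) \<squnion>\<^bsub>rs_order B\<^esub> (b \<otimes> c)"


section \<open>The ultrafilter semicategory\<close>

definition is_filter :: "('a, 'm) gorder_scheme \<Rightarrow> 'a set \<Rightarrow> bool" where
  "is_filter L F \<longleftrightarrow>
     F \<subseteq> carrier L \<and> F \<noteq> {} \<and>
     (\<forall>a\<in>F. \<forall>b\<in>carrier L. a \<sqsubseteq>\<^bsub>L\<^esub> b \<longrightarrow> b \<in> F) \<and>
     (\<forall>a\<in>F. \<forall>b\<in>F. \<exists>c\<in>F. c \<sqsubseteq>\<^bsub>L\<^esub> a \<and> c \<sqsubseteq>\<^bsub>L\<^esub> b)"

definition is_proper_filter :: "('a, 'm) gorder_scheme \<Rightarrow> 'a set \<Rightarrow> bool" where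
  "is_proper_filter L F \<longleftrightarrow> is_filter L F \<and> F \<noteq> carrier L"

definition is_ultrafilter :: "('a, 'm) gorder_scheme \<Rightarrow> 'a set \<Rightarrow> bool" where
  "is_ultrafilter L F \<longleftrightarrow>
     is_proper_filter L F \<and> (\<forall>G. is_proper_filter L G \<and> F \<subseteq> G \<longrightarrow> G = F)"

definition ultrafilters :: "('a, 'm) psemigroup_scheme \<Rightarrow> 'a set set" where
  "ultrafilters B = {U. is_ultrafilter (rs_order B) U}"

definition uf_units :: "('a, 'm) psemigroup_scheme \<Rightarrow> 'a set set" where
  "uf_units B = {U \<in> ultrafilters B. U \<inter> proj B \<noteq> {}}"

definition uf_source :: "('a, 'm) psemigroup_scheme \<Rightarrow> 'a set \<Rightarrow> 'a set" where
  "uf_source B U = {c \<in> carrier B. \<exists>u\<in>U. rs_le B (source B u) c}"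

definition uf_prod_defined :: "('a, 'm) zpsemigroup_scheme \<Rightarrow> 'a set \<Rightarrow> 'a set \<Rightarrow> bool" where
  "uf_prod_defined B V W \<longleftrightarrow> \<zero>\<^bsub>B\<^esub> \<notin> {v \<otimes>\<^bsub>B\<^esub> w | v w. v \<in> V \<and> w \<in> W}"

definition uf_prod :: "('a, 'm) psemigroup_scheme \<Rightarrow> 'a set \<Rightarrow> 'a set \<Rightarrow> 'a set" where
  "uf_prod B V W = {c \<in> carrier B. \<exists>v\<in>V. \<exists>w\<in>W. rs_le B (v \<otimes>\<^bsub>B\<^esub> w) c}"

definition basic_set :: "('a, 'm) psemigroup_scheme \<Rightarrow> 'a \<Rightarrow> 'a set set" where
  "basic_set B b = {U \<in> ultrafilters B. b \<in> U}"

text \<open>The topology is generated by the sets \<open>basic_set B b\<close> as a subbasis, so that it is a topology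
  for any \<open>B\<close>. That these sets form a basis for it has to be proved.\<close>

definition uf_topology :: "('a, 'm) psemigroup_scheme \<Rightarrow> 'a set topology" where
  "uf_topology B = topology_generated_by (basic_set B ` carrier B)"

lemma topspace_uf_topology: "topspace (uf_topology B) = ultrafilters B"
proof -
  have "U \<noteq> {} \<and> U \<subseteq> carrier B" if "U \<in> ultrafilters B" for U
    using that
    by (simp add: ultrafilters_def is_ultrafilter_def is_proper_filter_def is_filter_def rs_order_def)
  then show ?thesis
    unfolding uf_topology_def topology_generated_by_topspace basic_set_def by blast
qed

definition is_basis_of :: "'b set set \<Rightarrow> 'b topology \<Rightarrow> bool" where
  "is_basis_of \<N> X \<longleftrightarrow> openin X = arbitrary union_of (\<lambda>N. N \<in> \<N>)"


section \<open>Compact open sections\<close>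

definition is_section :: "('a, 'm) psemigroup_scheme \<Rightarrow> 'a set set \<Rightarrow> bool" where
  "is_section B N \<longleftrightarrow> N \<subseteq> ultrafilters B \<and> inj_on (uf_source B) N"

definition section_prod ::
    "('a, 'm) zpsemigroup_scheme \<Rightarrow> 'a set set \<Rightarrow> 'a set set \<Rightarrow> 'a set set" where
  "section_prod B M N = {uf_prod B V W | V W. V \<in> M \<and> W \<in> N \<and> uf_prod_defined B V W}"

definition is_compact_open :: "'b topology \<Rightarrow> 'b set \<Rightarrow> bool" where
  "is_compact_open X N \<longleftrightarrow> compactin X N \<and> openin X N"

definition compact_open_sections :: "('a, 'm) zpsemigroup_scheme \<Rightarrow> 'a set set psemigroup" where
  "compact_open_sections B =
     \<lparr>carrier = {N. is_compact_open (uf_topology B) N \<and> is_section B N},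
      mult = section_prod B,
      proj = {N. is_compact_open (uf_topology B) N \<and> N \<subseteq> uf_units B}\<rparr>"

definition basic_sections :: "('a, 'm) zpsemigroup_scheme \<Rightarrow> 'a set set psemigroup" where
  "basic_sections B =
     (compact_open_sections B)
       \<lparr>carrier := basic_set B ` carrier B, proj := basic_set B ` proj B\<rparr>"

end

theory Submission
  imports Defs
begin

text \<open>An element \<open>b\<close> has the ideal of its restrictions \<open>b \<otimes> p\<close>, which is order isomorphic to the ideal
  of projections below \<open>src b\<close>. Hence an ultrafilter through \<open>b\<close> is determined by its source, and
  any ultrafilter whose source contains \<open>src d \<preceq> src b\<close> can be moved to one through \<open>b\<close>. A product
  \<open>V \<cdot> W\<close> through \<open>a \<otimes> b\<close> is a proper filter containing the copy of \<open>W\<close> through \<open>a \<otimes> b\<close>, so it is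
  an ultrafilter. Conversely an ultrafilter through \<open>a \<otimes> b\<close> factors: the right factor is its copy
  through \<open>b\<close>, and the left factor consists of the elements above the \<open>a \<otimes> p\<close> with \<open>p \<otimes> b\<close> in the
  right factor. Thus \<open>b \<mapsto> O\<^sub>b\<close> is multiplicative. It is an order embedding by Zorn's lemma applied to
  relative complements, so the structure of \<open>B\<close> carries over to its image.\<close>

section \<open>Restriction semigroups\<close>

lemma carrier_rs_order [simp]: "carrier (rs_order B) = carrier B"
  by (simp add: rs_order_def)

lemma le_rs_order: "rs_le B a b \<longleftrightarrow> (\<exists>p\<in>proj B. a = b \<otimes>\<^bsub>B\<^esub> p)"
  by (simp add: rs_order_def)

context restriction_semigroup
begin

abbreviation leq :: "'a \<Rightarrow> 'a \<Rightarrow> bool" (infix "\<preceq>" 50)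
  where "a \<preceq> b \<equiv> rs_le B a b"

abbreviation src :: "'a \<Rightarrow> 'a"
  where "src a \<equiv> source B a"

lemma leq_iff: "a \<preceq> b \<longleftrightarrow> (\<exists>p\<in>proj B. a = b \<otimes> p)"
  by (rule le_rs_order)

lemma proj_carrier [simp]: "p \<in> proj B \<Longrightarrow> p \<in> carrier B"
  using proj_subset by blast

lemma leqI: "p \<in> proj B \<Longrightarrow> b \<otimes> p \<preceq> b"
  by (auto simp: leq_iff)

lemma leq_carrier: "\<lbrakk>a \<preceq> b; b \<in> carrier B\<rbrakk> \<Longrightarrow> a \<in> carrier B"
  by (auto simp: leq_iff mult_closed)

lemma leq_trans [trans]:
  assumes "a \<preceq> b" "b \<preceq> c" "c \<in> carrier B"
  shows "a \<preceq> c"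
proof -
  obtain p q where "p \<in> proj B" "q \<in> proj B" "a = c \<otimes> q \<otimes> p"
    using assms by (auto simp: leq_iff)
  then have "a = c \<otimes> (q \<otimes> p)"
    using assms(3) by (simp add: mult_assoc)
  then show ?thesis
    using \<open>p \<in> proj B\<close> \<open>q \<in> proj B\<close> by (simp add: leqI proj_closed)
qed

text \<open>If \<open>a = b \<otimes> p\<close> and \<open>b = a \<otimes> q\<close>, then
  \<open>b \<otimes> q = b\<close>, and commuting the projections gives \<open>a = b \<otimes> q
  \<otimes> p = b \<otimes> p \<otimes> q = a \<otimes> q = b\<close>.\<close>

lemma leq_antisym:
  assumes "a \<preceq> b" "b \<preceq> a" "b \<in> carrier B"
  shows "a = b"
proof -
  have a: "a \<in> carrier B"
    using assms leq_carrier by blast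
  obtain p q where pq: "p \<in> proj B" "q \<in> proj B" and ab: "b \<otimes> p = a" "a \<otimes> q = b"
    using assms unfolding leq_iff by metis
  have "a \<otimes> q \<otimes> q = a \<otimes> q"
    using pq a by (simp add: mult_assoc proj_idem)
  then have "a = b \<otimes> q \<otimes> p"
    by (simp only: ab)
  also have "\<dots> = b \<otimes> p \<otimes> q"
    using pq assms(3) by (simp add: mult_assoc proj_comm[of q p])
  also have "\<dots> = b"
    by (simp only: ab)
  finally show ?thesis .
qed

lemma source_is_source: "a \<in> carrier B \<Longrightarrow> is_source B a (src a)"
proof -
  assume "a \<in> carrier B"
  then obtain s where s: "is_source B a s"
    using source_exists by blast
  moreover have "t = s" if "is_source B a t" for t
    using that s unfolding is_source_def least_def by (auto intro!: leq_antisym)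
  ultimately show ?thesis
    unfolding source_def by (rule theI)
qed

lemma source_proj [simp]: "a \<in> carrier B \<Longrightarrow> src a \<in> proj B"
  and mult_source [simp]: "a \<in> carrier B \<Longrightarrow> a \<otimes> src a = a"
  and source_least: "\<lbrakk>a \<in> carrier B; p \<in> proj B; a \<otimes> p = a\<rbrakk> \<Longrightarrow> src a \<preceq> p"
  using source_is_source[of a] unfolding is_source_def least_def by auto

lemma source_carrier [simp]: "a \<in> carrier B \<Longrightarrow> src a \<in> carrier B"
  by simp

lemma leq_refl [simp]: "a \<in> carrier B \<Longrightarrow> a \<preceq> a"
  by (metis leqI mult_source source_proj)

lemma leq_proj:
  assumes "a \<preceq> p" "p \<in> proj B"
  shows "a \<in> proj B"
  using assms by (auto simp: leq_iff proj_closed)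

lemma proj_leq_iff:
  assumes "p \<in> proj B" "q \<in> proj B"
  shows "p \<preceq> q \<longleftrightarrow> q \<otimes> p = p"
proof
  assume "p \<preceq> q"
  then obtain r where "r \<in> proj B" "p = q \<otimes> r"
    by (auto simp: leq_iff)
  then show "q \<otimes> p = p"
    using assms by (metis mult_assoc proj_carrier proj_idem)
qed (metis assms(1) leqI)

lemma proj_mult_leq:
  assumes "p \<in> proj B" "q \<in> proj B"
  shows "p \<otimes> q \<preceq> p" "p \<otimes> q \<preceq> q"
  using assms leqI[of q p] leqI[of p q] by (simp_all add: proj_comm)

lemma mult_mono_left:
  assumes "a \<preceq> b" "b \<in> carrier B" "c \<in> carrier B"
  shows "c \<otimes> a \<preceq> c \<otimes> b"
proof -
  obtain p where "p \<in> proj B" "a = b \<otimes> p"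
    using assms by (auto simp: leq_iff)
  then have "c \<otimes> a = c \<otimes> b \<otimes> p"
    using assms by (simp add: mult_assoc)
  then show ?thesis
    using \<open>p \<in> proj B\<close> leqI by simp
qed

text \<open>Associativity moves the projection in \<open>a = b \<otimes> p\<close> over to
  \<open>c\<close>, where the axiom \<open>proj_mult_le\<close> absorbs it.\<close>

lemma mult_mono_right:
  assumes "a \<preceq> b" "b \<in> carrier B" "c \<in> carrier B"
  shows "a \<otimes> c \<preceq> b \<otimes> c"
proof -
  obtain p where "p \<in> proj B" "a = b \<otimes> p"
    using assms by (auto simp: leq_iff)
  then have "a \<otimes> c = b \<otimes> (p \<otimes> c)"
    using assms by (simp add: mult_assoc)
  then show ?thesis
    using proj_mult_le[OF \<open>p \<in> proj B\<close> assms(3)] mult_mono_left assms by simp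
qed

lemma mult_mono:
  assumes "a \<preceq> b" "c \<preceq> d" "b \<in> carrier B" "d \<in> carrier B"
  shows "a \<otimes> c \<preceq> b \<otimes> d"
proof -
  have "a \<otimes> c \<preceq> b \<otimes> c"
    using assms leq_carrier mult_mono_right by blast
  also have "b \<otimes> c \<preceq> b \<otimes> d"
    using assms mult_mono_left by blast
  finally show ?thesis
    using assms mult_closed by blast
qed

lemma source_of_proj [simp]:
  assumes "p \<in> proj B"
  shows "src p = p"
proof -
  have "src p \<preceq> p"
    using assms by (simp add: source_least proj_idem)
  moreover have "p \<preceq> src p"
    using assms by (metis leqI mult_source proj_carrier proj_comm source_proj)
  ultimately show ?thesis
    using assms leq_antisym by simp
qed

lemma source_mult_proj [simp]:
  assumes "a \<in> carrier B" "p \<in> proj B"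
  shows "src (a \<otimes> p) = src a \<otimes> p"
  using assms source_mult[of a p] by (simp add: proj_closed)

lemma source_mono:
  assumes "a \<preceq> b" "b \<in> carrier B"
  shows "src a \<preceq> src b"
  using assms by (auto simp: leq_iff)

lemma source_mult_leq:
  assumes "a \<in> carrier B" "b \<in> carrier B"
  shows "src (a \<otimes> b) \<preceq> src b"
  using assms by (auto intro!: source_least simp: mult_closed mult_assoc)

text \<open>An element below \<open>b\<close> is the restriction of \<open>b\<close> to its own
  source, so restrictions of \<open>b\<close> and projections below \<open>src b\<close> determine
  each other. This is what allows elements and filters to be moved from one principal ideal to
  another.\<close>

lemma mult_source_leq:
  assumes "a \<preceq> b" "b \<in> carrier B"
  shows "b \<otimes> src a = a"
proof -
  obtain p where p: "p \<in> proj B" "a = b \<otimes> p"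
    using assms by (auto simp: leq_iff)
  have "b \<otimes> src a = b \<otimes> (src b \<otimes> p)"
    using p assms(2) by simp
  also have "\<dots> = b \<otimes> src b \<otimes> p"
    using p(1) assms(2) by (simp only: mult_assoc source_carrier proj_carrier)
  finally show ?thesis
    using p assms(2) by simp
qed

end

section \<open>Transport of the structure along an injective multiplicative map\<close>

locale restriction_semigroup_copy = restriction_semigroup B
  for B :: "('a, 'm) psemigroup_scheme" (structure) +
  fixes C :: "('b, 'n) psemigroup_scheme" and f :: "'a \<Rightarrow> 'b"
  assumes inj: "inj_on f (carrier B)"
    and carrier_C: "carrier C = f ` carrier B"
    and proj_C: "proj C = f ` proj B"
    and mult_C: "\<lbrakk>a \<in> carrier B; b \<in> carrier B\<rbrakk> \<Longrightarrow> f a \<otimes>\<^bsub>C\<^esub> f b = f (a \<otimes> b)"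
begin

lemma f_eq_iff: "\<lbrakk>a \<in> carrier B; b \<in> carrier B\<rbrakk> \<Longrightarrow> f a = f b \<longleftrightarrow> a = b"
  using inj by (rule inj_on_eq_iff)

lemma le_C_iff:
  assumes "a \<in> carrier B" "b \<in> carrier B"
  shows "rs_le C (f a) (f b) \<longleftrightarrow> a \<preceq> b"
  using assms by (auto simp: le_rs_order proj_C mult_C f_eq_iff mult_closed)

lemma is_source_C_iff:
  assumes "a \<in> carrier B" "s \<in> carrier B"
  shows "is_source C (f a) (f s) \<longleftrightarrow> is_source B a s"
proof -
  have "{q \<in> proj C. f a \<otimes>\<^bsub>C\<^esub> q = f a} = f ` {p \<in> proj B. a \<otimes> p = a}"
    using assms by (auto simp: proj_C mult_C f_eq_iff mult_closed)
  moreover have "f s \<in> f ` {p \<in> proj B. a \<otimes> p = a} \<longleftrightarrow> s \<in> {p \<in> proj B. a \<otimes> p = a}"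
    using assms(2) proj_subset by (intro inj_on_image_mem_iff[OF inj]) auto
  ultimately show ?thesis
    unfolding is_source_def least_def
    using assms proj_subset by (auto simp: le_C_iff carrier_C)
qed

text \<open>Uniqueness of the source in \<open>C\<close> is inherited from \<open>B\<close>: a
  candidate lies in \<open>proj C\<close>, so it is the image of a projection, and antisymmetry in
  \<open>B\<close> identifies that projection with \<open>src a\<close>.\<close>

lemma source_C:
  assumes "a \<in> carrier B"
  shows "source C (f a) = f (src a)"
  unfolding source_def[of C]
proof (rule the_equality)
  show "is_source C (f a) (f (src a))"
    using assms is_source_C_iff source_is_source by simp
next
  fix t
  assume t: "is_source C (f a) t"
  then have "t \<in> proj C"
    by (simp add: is_source_def least_def)
  then obtain s where s: "s \<in> proj B" "t = f s"
    by (auto simp: proj_C)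
  then have "is_source B a s"
    using t assms is_source_C_iff by simp
  then have "s \<preceq> src a" "src a \<preceq> s"
    using source_is_source[OF assms] by (auto simp: is_source_def least_def)
  then show "t = f (src a)"
    using s(2) leq_antisym[of s "src a"] assms by simp
qed

lemma restriction_semigroup_C: "restriction_semigroup C"
proof
  fix a
  assume "a \<in> carrier C"
  then obtain b where "b \<in> carrier B" "a = f b"
    by (auto simp: carrier_C)
  then show "\<exists>s. is_source C a s"
    using is_source_C_iff source_is_source by (intro exI[of _ "f (src b)"]) simp
next
  fix p b
  assume "p \<in> proj C" "b \<in> carrier C"
  then show "rs_le C (p \<otimes>\<^bsub>C\<^esub> b) b"
    using proj_mult_le by (auto simp: carrier_C proj_C mult_C le_C_iff mult_closed)
next
  fix a b
  assume "a \<in> carrier C" "b \<in> carrier C"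
  then obtain x y where xy: "x \<in> carrier B" "y \<in> carrier B" "a = f x" "b = f y"
    by (auto simp: carrier_C)
  have "src (x \<otimes> y) = src (src x \<otimes> y)"
    using xy by (intro source_mult)
  then show "source C (a \<otimes>\<^bsub>C\<^esub> b) = source C (source C a \<otimes>\<^bsub>C\<^esub> b)"
    using xy by (simp add: mult_C source_C mult_closed)
next
  fix p q
  assume "p \<in> proj C" "q \<in> proj C"
  then show "p \<otimes>\<^bsub>C\<^esub> q = q \<otimes>\<^bsub>C\<^esub> p"
    using proj_comm by (auto simp: proj_C mult_C)
qed (auto simp: carrier_C proj_C mult_C mult_closed mult_assoc proj_closed proj_idem)

end

section \<open>Complements and joins in semi-Boolean restriction semigroups\<close>

context semi_boolean_restriction_semigroup
begin

lemma zero_carrier [simp]: "\<zero> \<in> carrier B"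
  using zero_proj by simp

lemma zero_leq [simp]:
  assumes "b \<in> carrier B"
  shows "\<zero> \<preceq> b"
  using proj_mult_le[OF zero_proj assms] zero_mult[OF assms] by simp

lemma leq_zero [simp]: "a \<preceq> \<zero> \<longleftrightarrow> a = \<zero>"
proof
  assume "a \<preceq> \<zero>"
  then show "a = \<zero>"
    unfolding leq_iff using zero_mult by force
qed simp

lemma mult_zero [simp]:
  assumes "b \<in> carrier B"
  shows "b \<otimes> \<zero> = \<zero>"
  using mult_source_leq[OF zero_leq[OF assms] assms] by (simp add: zero_proj)

lemma source_eq_zero [simp]:
  assumes "a \<in> carrier B"
  shows "src a = \<zero> \<longleftrightarrow> a = \<zero>"
proof
  assume "src a = \<zero>"
  then show "a = \<zero>"
    using mult_source[OF assms] mult_zero[OF assms] by simp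
qed (simp add: zero_proj)

text \<open>Disjointness is phrased by common lower bounds, so that it does not depend on the ideal
  in which a meet is computed.\<close>

definition orth :: "'a \<Rightarrow> 'a \<Rightarrow> bool"
  where "orth a b \<longleftrightarrow> (\<forall>c. c \<preceq> a \<longrightarrow> c \<preceq> b \<longrightarrow> c = \<zero>)"

lemma orth_sym: "orth a b \<Longrightarrow> orth b a"
  by (simp add: orth_def)

lemma orthD: "\<lbrakk>orth a b; c \<preceq> a; c \<preceq> b\<rbrakk> \<Longrightarrow> c = \<zero>"
  by (simp add: orth_def)

lemma orth_mono: "\<lbrakk>orth a b; a' \<preceq> a; a \<in> carrier B\<rbrakk> \<Longrightarrow> orth a' b"
  unfolding orth_def using leq_trans by blast

text \<open>The source of a common lower bound lies below both \<open>src x\<close> and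
  \<open>src y\<close>, so it is absorbed by their product, which is zero.\<close>

lemma source_orth:
  assumes "x \<in> carrier B" "y \<in> carrier B" "src x \<otimes> src y = \<zero>"
  shows "orth x y"
  unfolding orth_def
proof (intro allI impI)
  fix c
  assume c: "c \<preceq> x" "c \<preceq> y"
  then have cB: "c \<in> carrier B"
    using assms leq_carrier by blast
  have "src c = src x \<otimes> (src y \<otimes> src c)"
    using c assms cB source_mono by (metis proj_leq_iff source_proj)
  also have "\<dots> = src x \<otimes> src y \<otimes> src c"
    using assms cB mult_assoc[of "src x" "src y" "src c"] by simp
  finally show "c = \<zero>"
    using assms cB by (simp add: zero_mult)
qed

text \<open>The common upper bound makes the two cross restrictions agree:
  \<open>x \<otimes> src y\<close> and \<open>y \<otimes> src x\<close> both equal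
  \<open>d \<otimes> (src x \<otimes> src y)\<close>. Their value is thus a common lower bound of
  \<open>x\<close> and \<open>y\<close>, hence zero.\<close>

lemma orth_source:
  assumes "x \<preceq> d" "y \<preceq> d" "d \<in> carrier B" "orth x y"
  shows "src x \<otimes> src y = \<zero>"
proof -
  have xy: "x \<in> carrier B" "y \<in> carrier B"
    using assms leq_carrier by blast+
  have "x \<otimes> src y = d \<otimes> (src x \<otimes> src y)"
    using mult_assoc[of d "src x" "src y"] mult_source_leq[OF assms(1,3)] assms(3) xy by simp
  also have "\<dots> = y \<otimes> src x"
    using mult_assoc[of d "src y" "src x"] mult_source_leq[OF assms(2,3)] assms(3) xy
      proj_comm[of "src x" "src y"] by simp
  finally have "x \<otimes> src y \<preceq> y"
    using leqI[of "src x" y] xy by simp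
  then have "x \<otimes> src y = \<zero>"
    using assms(4) leqI[of "src y" x] xy orthD by simp
  then have "src (x \<otimes> src y) = \<zero>"
    by (simp add: zero_proj)
  then show ?thesis
    using xy by simp
qed

section \<open>Meets, joins and relative complements\<close>

lemma ex_meet:
  assumes "a \<in> carrier B" "b \<in> carrier B"
  obtains c where "c \<preceq> a" "c \<preceq> b" "\<And>d. \<lbrakk>d \<preceq> a; d \<preceq> b\<rbrakk> \<Longrightarrow> d \<preceq> c"
proof -
  have "lower_semilattice (rs_order B)"
    using semi_boolean by (simp add: semi_boolean_algebra_def)
  then obtain c where c: "greatest (rs_order B) c (Lower (rs_order B) {a, b})"
    using assms lower_semilattice.inf_of_two_exists[of "rs_order B" a b] by auto
  have "d \<preceq> c" if "d \<preceq> a" "d \<preceq> b" for d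
    using c that assms leq_carrier[of d a] by (auto simp: greatest_def Lower_def)
  then show thesis
    using that c assms by (auto simp: greatest_def Lower_def)
qed

definition ideal :: "'a \<Rightarrow> 'a gorder"
  where "ideal d = rs_order B\<lparr>carrier := {c \<in> carrier B. c \<preceq> d}\<rparr>"

lemma carrier_ideal [simp]: "carrier (ideal d) = {c \<in> carrier B. c \<preceq> d}"
  and le_ideal [simp]: "le (ideal d) = rs_le B"
  by (simp_all add: ideal_def)

lemma boolean_ideal: "d \<in> carrier B \<Longrightarrow> boolean_lattice (ideal d)"
  using semi_boolean by (simp add: semi_boolean_algebra_def ideal_def)

text \<open>An upper bound \<open>z\<close> from outside the ideal is replaced by its meet with
  \<open>d\<close>, which is still an upper bound and lies in the ideal.\<close>

lemma is_lub_ideal: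
  assumes "d \<in> carrier B" "x \<preceq> d" "y \<preceq> d" "least (ideal d) j (Upper (ideal d) {x, y})"
  shows "least (rs_order B) j (Upper (rs_order B) {x, y})"
proof -
  have xy: "x \<in> carrier B" "y \<in> carrier B"
    using assms leq_carrier by blast+
  have j: "j \<in> carrier B" "j \<preceq> d" "x \<preceq> j" "y \<preceq> j"
    and jl: "\<And>m. \<lbrakk>m \<preceq> d; x \<preceq> m; y \<preceq> m\<rbrakk> \<Longrightarrow> j \<preceq> m"
    using assms xy leq_carrier[of _ d] by (auto simp: least_def Upper_def)
  have "j \<preceq> z" if z: "z \<in> carrier B" "x \<preceq> z" "y \<preceq> z" for z
  proof -
    obtain m where m: "m \<preceq> z" "m \<preceq> d" "\<And>c. \<lbrakk>c \<preceq> z; c \<preceq> d\<rbrakk> \<Longrightarrow> c \<preceq> m"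
      using ex_meet[OF z(1) assms(1)] by blast
    then have "j \<preceq> m"
      using jl z assms by blast
    then show ?thesis
      using m z leq_trans by blast
  qed
  then show ?thesis
    using j xy by (auto simp: least_def Upper_def)
qed

text \<open>The lattice join is a Hilbert choice among least upper bounds; antisymmetry of
  \<open>\<preceq>\<close> leaves a single candidate.\<close>

lemma join_eqI:
  assumes "least (rs_order B) j (Upper (rs_order B) {x, y})"
  shows "x \<squnion>\<^bsub>rs_order B\<^esub> y = j"
  unfolding join_def sup_def
proof (rule some_equality)
  fix k
  assume "least (rs_order B) k (Upper (rs_order B) {x, y})"
  then show "k = j"
    using assms by (auto simp: least_def Upper_def intro!: leq_antisym)
qed (rule assms)

lemma ex_lub:
  assumes "d \<in> carrier B" "x \<preceq> d" "y \<preceq> d"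
  shows "\<exists>j. least (rs_order B) j (Upper (rs_order B) {x, y})"
proof -
  have "upper_semilattice (ideal d)"
    using boolean_ideal[OF assms(1)]
    by (simp add: boolean_lattice_def bounded_lattice_def lattice_def)
  then obtain j where "least (ideal d) j (Upper (ideal d) {x, y})"
    using upper_semilattice.sup_of_two_exists[of "ideal d" x y] assms leq_carrier[of _ d] by auto
  then show ?thesis
    using is_lub_ideal[OF assms] by blast
qed

text \<open>This describes the complement in the Boolean ideal of \<open>d\<close> without the
  operations of that ideal. Its maximality among the elements disjoint from \<open>x\<close> comes
  from distributivity. The join is taken in the whole poset so that the axiom
  \<open>join_mult\<close> applies to it.\<close>

lemma ex_complement:
  assumes "d \<in> carrier B" "x \<preceq> d"
  obtains y where "y \<preceq> d" "orth x y" "\<And>u. \<lbrakk>u \<preceq> d; orth u x\<rbrakk> \<Longrightarrow> u \<preceq> y"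
    "x \<squnion>\<^bsub>rs_order B\<^esub> y = d" "y = \<zero> \<Longrightarrow> x = d"
proof -
  interpret L: bounded_lattice "ideal d"
    using boolean_ideal[OF assms(1)] by (simp add: boolean_lattice_def)
  have car: "c \<in> carrier (ideal d)" if "c \<preceq> d" for c
    using that assms leq_carrier by simp
  have bot: "\<bottom>\<^bsub>ideal d\<^esub> = \<zero>"
    using assms by (intro L.bottom_eq[symmetric]) simp_all
  have top: "\<top>\<^bsub>ideal d\<^esub> = d"
    using assms by (intro L.top_eq[symmetric]) simp_all
  obtain y where y: "y \<in> carrier (ideal d)" "x \<sqinter>\<^bsub>ideal d\<^esub> y = \<zero>" "x \<squnion>\<^bsub>ideal d\<^esub> y = d"
    using boolean_ideal[OF assms(1)] car[OF assms(2)] unfolding boolean_lattice_def bot top by blast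
  have orth_meet: "orth u v \<longleftrightarrow> u \<sqinter>\<^bsub>ideal d\<^esub> v = \<zero>" if "u \<preceq> d" "v \<preceq> d" for u v
  proof
    assume "orth u v"
    then show "u \<sqinter>\<^bsub>ideal d\<^esub> v = \<zero>"
      using L.meet_left[of u v] L.meet_right[of u v] car[OF that(1)] car[OF that(2)] orthD[of u v]
      by simp
  next
    assume *: "u \<sqinter>\<^bsub>ideal d\<^esub> v = \<zero>"
    show "orth u v"
      unfolding orth_def
    proof (intro allI impI)
      fix c
      assume c: "c \<preceq> u" "c \<preceq> v"
      then have "c \<preceq> d"
        using that assms leq_trans by blast
      then have "c \<preceq> u \<sqinter>\<^bsub>ideal d\<^esub> v"
        using c car that L.meet_le[of c u v] by simp
      then show "c = \<zero>"
        using * by simp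
    qed
  qed
  have max: "u \<preceq> y" if u: "u \<preceq> d" "orth u x" for u
  proof -
    have "u = u \<sqinter>\<^bsub>ideal d\<^esub> (x \<squnion>\<^bsub>ideal d\<^esub> y)"
      using L.meet_le[of u u d] L.meet_left[of u d] L.meet_closed[of u d] car[OF u(1)] u(1) y(3)
        assms(1)
      by (intro L.le_antisym) simp_all
    also have "\<dots> = (u \<sqinter>\<^bsub>ideal d\<^esub> x) \<squnion>\<^bsub>ideal d\<^esub> (u \<sqinter>\<^bsub>ideal d\<^esub> y)"
      using boolean_ideal[OF assms(1)] car[OF u(1)] car[OF assms(2)] y(1)
      unfolding boolean_lattice_def by blast
    also have "\<dots> \<preceq> y"
    proof -
      have "u \<sqinter>\<^bsub>ideal d\<^esub> x = \<zero>"
        using u assms orth_meet[of u x] by blast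
      then have "le (ideal d) (u \<sqinter>\<^bsub>ideal d\<^esub> x) y"
        using y(1) by simp
      then have "le (ideal d) ((u \<sqinter>\<^bsub>ideal d\<^esub> x) \<squnion>\<^bsub>ideal d\<^esub> (u \<sqinter>\<^bsub>ideal d\<^esub> y)) y"
        using L.meet_right[OF car[OF u(1)] y(1)] y(1) car[OF assms(2)] car[OF u(1)]
        by (intro L.join_le L.meet_closed)
      then show ?thesis
        by simp
    qed
    finally show ?thesis .
  qed
  have "least (ideal d) d (Upper (ideal d) {x, y})"
    using L.sup_of_two_least[OF car[OF assms(2)] y(1)] y(3)[unfolded join_def]
    by (rule back_subst[of "\<lambda>j. least (ideal d) j (Upper (ideal d) {x, y})"])
  then have join: "x \<squnion>\<^bsub>rs_order B\<^esub> y = d"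
    using y(1) assms by (intro join_eqI is_lub_ideal[of d]) simp_all
  have "x = d" if "y = \<zero>"
  proof -
    have "x \<in> carrier B"
      using assms leq_carrier by blast
    then have "le (ideal d) (x \<squnion>\<^bsub>ideal d\<^esub> y) x"
      using car[OF assms(2)] y(1) that assms(1) by (intro L.join_le) simp_all
    then have "d \<preceq> x"
      unfolding y(3) by simp
    then show ?thesis
      using assms leq_antisym by blast
  qed
  then show thesis
    using that[of y] y(1,2) orth_meet[of x y] assms(2) max join by simp
qed

text \<open>Right distributivity in terms of upper bounds. The join in \<open>join_mult\<close> is a
  genuine least upper bound because \<open>x \<otimes> c\<close> and \<open>y \<otimes> c\<close>
  lie in the ideal of \<open>d \<otimes> c\<close>.\<close>

lemma join_mult_least:
  assumes "d \<in> carrier B" "x \<preceq> d" "y \<preceq> d" "x \<squnion>\<^bsub>rs_order B\<^esub> y = d" "c \<in> carrier B"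
    and "z \<in> carrier B" "x \<otimes> c \<preceq> z" "y \<otimes> c \<preceq> z"
  shows "d \<otimes> c \<preceq> z"
proof -
  have xy: "x \<in> carrier B" "y \<in> carrier B"
    using assms leq_carrier by blast+
  obtain j where j: "least (rs_order B) j (Upper (rs_order B) {x \<otimes> c, y \<otimes> c})"
    using ex_lub[of "d \<otimes> c"] assms mult_mono_right mult_closed by meson
  have "d \<otimes> c = j"
    using join_mult[OF xy assms(5)] assms(1-4) join_eqI[OF j] by auto
  then show ?thesis
    using j assms by (auto simp: least_def Upper_def)
qed

section \<open>Ultrafilters\<close>

abbreviation proper :: "'a set \<Rightarrow> bool"
  where "proper F \<equiv> is_proper_filter (rs_order B) F"

text \<open>Zero is the minimum, so an up-set is the whole carrier exactly when it contains
  zero.\<close>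

lemma proper_iff:
  "proper F \<longleftrightarrow> F \<subseteq> carrier B \<and> F \<noteq> {} \<and> (\<forall>a\<in>F. \<forall>b\<in>carrier B. a \<preceq> b \<longrightarrow> b \<in> F) \<and>
     (\<forall>a\<in>F. \<forall>b\<in>F. \<exists>c\<in>F. c \<preceq> a \<and> c \<preceq> b) \<and> \<zero> \<notin> F"
proof -
  have "\<zero> \<in> F \<longleftrightarrow> F = carrier B"
    if "F \<subseteq> carrier B" "\<forall>a\<in>F. \<forall>b\<in>carrier B. a \<preceq> b \<longrightarrow> b \<in> F"
    using that by auto
  then show ?thesis
    unfolding is_proper_filter_def is_filter_def carrier_rs_order by blast
qed

lemma properD:
  assumes "proper F"
  shows proper_carrier: "a \<in> F \<Longrightarrow> a \<in> carrier B"
    and proper_up: "\<lbrakk>a \<in> F; a \<preceq> b; b \<in> carrier B\<rbrakk> \<Longrightarrow> b \<in> F"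
    and proper_dir: "\<lbrakk>a \<in> F; b \<in> F\<rbrakk> \<Longrightarrow> \<exists>c\<in>F. c \<preceq> a \<and> c \<preceq> b"
    and proper_nonzero: "\<zero> \<notin> F"
    and proper_nonempty: "F \<noteq> {}"
  using assms unfolding proper_iff by blast+

definition upc :: "'a set \<Rightarrow> 'a set"
  where "upc D = {c \<in> carrier B. \<exists>d\<in>D. d \<preceq> c}"

lemma upcI: "\<lbrakk>d \<in> D; d \<preceq> c; c \<in> carrier B\<rbrakk> \<Longrightarrow> c \<in> upc D"
  by (auto simp: upc_def)

lemma proper_upc:
  assumes "D \<subseteq> carrier B" "D \<noteq> {}" "\<zero> \<notin> D"
    and dir: "\<And>a b. \<lbrakk>a \<in> D; b \<in> D\<rbrakk> \<Longrightarrow> \<exists>c\<in>D. c \<preceq> a \<and> c \<preceq> b"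
  shows "proper (upc D)"
  unfolding proper_iff
proof (intro conjI ballI impI)
  obtain d where "d \<in> D"
    using assms by blast
  then show "upc D \<noteq> {}"
    using assms upcI[of d D d] by auto
next
  fix a b
  assume "a \<in> upc D" "b \<in> upc D"
  then obtain d e where de: "d \<in> D" "d \<preceq> a" "e \<in> D" "e \<preceq> b" "a \<in> carrier B" "b \<in> carrier B"
    by (auto simp: upc_def)
  then obtain c where "c \<in> D" "c \<preceq> d" "c \<preceq> e"
    using dir by blast
  then show "\<exists>c\<in>upc D. c \<preceq> a \<and> c \<preceq> b"
    using de assms(1) leq_trans[of c d a] leq_trans[of c e b] upcI[of c D c] by auto
qed (use assms in \<open>auto simp: upc_def intro: leq_trans\<close>)

lemma ultrafilters_iff:
  "U \<in> ultrafilters B \<longleftrightarrow> proper U \<and> (\<forall>G. proper G \<and> U \<subseteq> G \<longrightarrow> G = U)"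
  by (simp add: ultrafilters_def is_ultrafilter_def)

lemma ultrafilter_proper: "U \<in> ultrafilters B \<Longrightarrow> proper U"
  by (simp add: ultrafilters_iff)

lemmas uf_carrier = proper_carrier[OF ultrafilter_proper]
  and uf_up = proper_up[OF ultrafilter_proper]
  and uf_dir = proper_dir[OF ultrafilter_proper]
  and uf_nonzero = proper_nonzero[OF ultrafilter_proper]

lemma ultrafilter_eqI: "\<lbrakk>U \<in> ultrafilters B; proper G; U \<subseteq> G\<rbrakk> \<Longrightarrow> G = U"
  by (auto simp: ultrafilters_iff)

text \<open>A strictly larger proper filter would contain some \<open>g\<close> outside
  \<open>U\<close> together with an element disjoint from \<open>g\<close>, hence zero.\<close>

lemma ultrafilterI:
  assumes "proper U" "\<And>g. \<lbrakk>g \<in> carrier B; g \<notin> U\<rbrakk> \<Longrightarrow> \<exists>u\<in>U. orth u g"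
  shows "U \<in> ultrafilters B"
  unfolding ultrafilters_iff
proof (intro conjI allI impI assms(1))
  fix G
  assume G: "proper G \<and> U \<subseteq> G"
  have "g \<in> U" if g: "g \<in> G" for g
  proof (rule ccontr)
    assume "g \<notin> U"
    then obtain u where u: "u \<in> U" "orth u g"
      using assms(2) G g proper_carrier by blast
    then obtain c where "c \<in> G" "c \<preceq> u" "c \<preceq> g"
      using G g proper_dir by blast
    then show False
      using u G proper_nonzero orthD by blast
  qed
  then show "G = U"
    using G by blast
qed

text \<open>This is the converse of \<open>ultrafilterI\<close>, in a form that places the witness
  below a given \<open>d\<close>. If no element of \<open>U\<close> were disjoint from
  \<open>b\<close>, the meets with \<open>b\<close> would generate a proper filter containing both
  \<open>U\<close> and \<open>b\<close>.\<close>

lemma ultrafilter_orth: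
  assumes U: "U \<in> ultrafilters B" and "b \<in> carrier B" "b \<notin> U" "d \<in> U"
  obtains u where "u \<in> U" "u \<preceq> d" "orth u b"
proof -
  \<comment> \<open>\<open>D\<close> consists of the meets of \<open>b\<close> with the elements of
    \<open>U\<close>.\<close>
  define D where "D = {c. \<exists>u\<in>U. c \<preceq> u \<and> c \<preceq> b \<and> (\<forall>x. x \<preceq> u \<longrightarrow> x \<preceq> b \<longrightarrow> x \<preceq> c)}"
  have D_carrier: "D \<subseteq> carrier B"
    using assms(2) by (auto simp: D_def intro: leq_carrier)
  have D_ex: "\<exists>c\<in>D. c \<preceq> u \<and> c \<preceq> b" if u: "u \<in> U" for u
  proof -
    obtain c where "c \<preceq> u" "c \<preceq> b" "\<And>x. \<lbrakk>x \<preceq> u; x \<preceq> b\<rbrakk> \<Longrightarrow> x \<preceq> c"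
      using ex_meet[OF uf_carrier[OF U u] assms(2)] by metis
    then show ?thesis
      using u by (intro bexI[of _ c]) (auto simp: D_def)
  qed
  have "\<zero> \<in> D"
  proof (rule ccontr)
    assume "\<zero> \<notin> D"
    have "proper (upc D)"
    proof (rule proper_upc)
      fix x y
      assume "x \<in> D" "y \<in> D"
      then obtain u v where uv: "u \<in> U" "\<forall>z. z \<preceq> u \<longrightarrow> z \<preceq> b \<longrightarrow> z \<preceq> x"
        "v \<in> U" "\<forall>z. z \<preceq> v \<longrightarrow> z \<preceq> b \<longrightarrow> z \<preceq> y"
        unfolding D_def by blast
      then obtain w where w: "w \<in> U" "w \<preceq> u" "w \<preceq> v"
        using uf_dir[OF U] by blast
      obtain c where c: "c \<in> D" "c \<preceq> w" "c \<preceq> b"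
        using D_ex w by blast
      have "c \<preceq> u"
        using leq_trans[OF c(2) w(2)] uf_carrier[OF U uv(1)] by simp
      moreover have "c \<preceq> v"
        using leq_trans[OF c(2) w(3)] uf_carrier[OF U uv(3)] by simp
      ultimately show "\<exists>c\<in>D. c \<preceq> x \<and> c \<preceq> y"
        using c uv by blast
    next
      show "D \<noteq> {}"
        using D_ex[OF assms(4)] by blast
    qed (rule D_carrier \<open>\<zero> \<notin> D\<close>)+
    moreover have "U \<subseteq> upc D"
      using D_ex uf_carrier[OF U] by (fastforce simp: upc_def)
    ultimately have "upc D = U"
      using U ultrafilter_eqI by blast
    moreover have "b \<in> upc D"
      using D_ex[OF assms(4)] assms(2) upcI by blast
    ultimately show False
      using assms by simp
  qed
  then obtain v where v: "v \<in> U" "orth v b"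
    by (auto simp: D_def orth_def)
  then obtain u where u: "u \<in> U" "u \<preceq> v" "u \<preceq> d"
    using uf_dir[OF U _ assms(4), of v] by blast
  have "orth u b"
    using orth_mono[OF v(2) u(2) uf_carrier[OF U v(1)]] .
  then show thesis
    using that[OF u(1,3)] by simp
qed

text \<open>Zorn's lemma applies since the union of a non-empty chain of proper filters is a proper
  filter.\<close>

lemma ultrafilter_extend:
  assumes "proper F"
  obtains U where "U \<in> ultrafilters B" "F \<subseteq> U"
proof -
  have "\<exists>M\<in>{G. proper G \<and> F \<subseteq> G}. \<forall>X\<in>{G. proper G \<and> F \<subseteq> G}. M \<subseteq> X \<longrightarrow> X = M"
  proof (rule subset_Zorn)
    fix C
    assume C: "subset.chain {G. proper G \<and> F \<subseteq> G} C"
    show "\<exists>M\<in>{G. proper G \<and> F \<subseteq> G}. \<forall>X\<in>C. X \<subseteq> M"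
    \<comment> \<open>The union of the empty chain is empty and not a filter; there \<open>F\<close>
      itself serves as the bound.\<close>
    proof (cases "C = {}")
      case False
      have Cp: "proper X" "F \<subseteq> X" if "X \<in> C" for X
        using C that by (auto simp: subset_chain_def)
      have "proper (\<Union>C)"
        unfolding proper_iff
      proof (intro conjI ballI impI)
        fix a b
        assume "a \<in> \<Union>C" "b \<in> \<Union>C"
        then obtain X where "X \<in> C" "a \<in> X" "b \<in> X"
          using C unfolding subset_chain_def by blast
        then show "\<exists>c\<in>\<Union>C. c \<preceq> a \<and> c \<preceq> b"
          using proper_dir[OF Cp(1)] by blast
      next
        show "\<Union>C \<noteq> {}"
          using False Cp proper_nonempty by fastforce
      next
        show "\<Union>C \<subseteq> carrier B"
          using proper_carrier[OF Cp(1)] by blast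
      next
        fix a b
        assume "a \<in> \<Union>C" "b \<in> carrier B" "a \<preceq> b"
        then show "b \<in> \<Union>C"
          using proper_up[OF Cp(1)] by blast
      next
        show "\<zero> \<notin> \<Union>C"
          using proper_nonzero[OF Cp(1)] by blast
      qed
      then show ?thesis
        using False Cp by blast
    qed (use assms in blast)
  qed
  then obtain M where "M \<in> {G. proper G \<and> F \<subseteq> G}"
    "\<forall>X\<in>{G. proper G \<and> F \<subseteq> G}. M \<subseteq> X \<longrightarrow> X = M"
    by (rule bexE)
  then have M: "proper M" "F \<subseteq> M" "\<And>X. \<lbrakk>proper X; F \<subseteq> X; M \<subseteq> X\<rbrakk> \<Longrightarrow> X = M"
    by simp_all
  have "M \<in> ultrafilters B"
    unfolding ultrafilters_iff
  proof (intro conjI allI impI M(1))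
    fix G
    assume "proper G \<and> M \<subseteq> G"
    then show "G = M"
      using M(3)[of G] M(2) subset_trans[of F M G] by simp
  qed
  then show thesis
    using that M(2) by simp
qed

lemma ultrafilter_containing:
  assumes "b \<in> carrier B" "b \<noteq> \<zero>"
  obtains U where "U \<in> ultrafilters B" "b \<in> U"
proof -
  have "proper (upc {b})"
    using assms by (intro proper_upc) auto
  then obtain U where "U \<in> ultrafilters B" "upc {b} \<subseteq> U"
    using ultrafilter_extend by blast
  then show thesis
    using that assms upcI[of b "{b}" b] by auto
qed

text \<open>Ultrafilters are prime for joins. If both parts were missing, some
  \<open>v \<preceq> d\<close> in \<open>U\<close> would be disjoint from \<open>x\<close> and from
  \<open>y\<close>, hence from their join \<open>d\<close>, which is absurd.\<close>

lemma ultrafilter_prime: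
  assumes U: "U \<in> ultrafilters B" and d: "d \<in> U" and xy: "x \<preceq> d" "y \<preceq> d"
    and least: "\<And>z. \<lbrakk>z \<in> carrier B; x \<preceq> z; y \<preceq> z\<rbrakk> \<Longrightarrow> d \<preceq> z"
  shows "x \<in> U \<or> y \<in> U"
proof (rule ccontr)
  assume *: "\<not> (x \<in> U \<or> y \<in> U)"
  have dB: "d \<in> carrier B"
    using U d uf_carrier by blast
  obtain u where u: "u \<in> U" "u \<preceq> d" "orth u x"
    using ultrafilter_orth[OF U _ _ d, of x] * leq_carrier[OF xy(1) dB] by blast
  obtain v where v: "v \<in> U" "v \<preceq> u" "orth v y"
    using ultrafilter_orth[OF U _ _ u(1), of y] * leq_carrier[OF xy(2) dB] by blast
  have v': "v \<preceq> d" "orth v x"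
    using leq_trans[OF v(2) u(2) dB] orth_mono[OF u(3) v(2) uf_carrier[OF U u(1)]] by simp_all
  \<comment> \<open>The complement \<open>z\<close> of \<open>v\<close> in the ideal of
    \<open>d\<close> lies above everything there that is disjoint from \<open>v\<close>, so it
    bounds \<open>x\<close> and \<open>y\<close>.\<close>
  obtain z where z: "z \<preceq> d" "orth v z" "\<And>w. \<lbrakk>w \<preceq> d; orth w v\<rbrakk> \<Longrightarrow> w \<preceq> z"
    using ex_complement[OF dB v'(1)] by metis
  have zB: "z \<in> carrier B"
    using leq_carrier[OF z(1) dB] .
  have "d \<preceq> z"
    using least[OF zB] z(3)[OF xy(1)] z(3)[OF xy(2)] v' v(3) orth_sym by blast
  then have "v \<preceq> z"
    using leq_trans[OF v'(1) _ zB] by simp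
  then have "v = \<zero>"
    using orthD[OF z(2)] uf_carrier[OF U v(1)] by simp
  then show False
    using v uf_nonzero[OF U] by simp
qed

text \<open>The ultrafilter through \<open>b\<close> with the same source unit as \<open>U\<close>; sensible only if \<open>src d \<preceq> src b\<close> for
  some \<open>d \<in> U\<close>.\<close>

definition transport :: "'a \<Rightarrow> 'a set \<Rightarrow> 'a set"
  where "transport b U = upc ((\<lambda>u. b \<otimes> src u) ` U)"

text \<open>Below \<open>d\<close>, passing from \<open>u\<close> to
  \<open>b \<otimes> src u\<close> preserves sources, so no zero arises. For maximality, an element
  outside the new filter is moved back below \<open>d\<close>, separated from \<open>U\<close>
  there, and the disjointness is returned through the sources.\<close>

lemma transport_ultrafilter:
  assumes U: "U \<in> ultrafilters B" and d: "d \<in> U" and b: "b \<in> carrier B" "src d \<preceq> src b"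
  shows "transport b U \<in> ultrafilters B" "b \<in> transport b U"
proof -
  have UB: "u \<in> carrier B" if "u \<in> U" for u
    using that U uf_carrier by blast
  have src_eq: "src (b \<otimes> src u) = src u" if "u \<in> U" "u \<preceq> d" for u
  proof -
    have "src u \<preceq> src b"
      using leq_trans[OF source_mono[OF that(2)] b(2)] b(1) d UB by simp
    then show ?thesis
      using b that UB proj_leq_iff by simp
  qed
  have nonzero: "b \<otimes> src u \<noteq> \<zero>" if u: "u \<in> U" for u
  proof
    assume *: "b \<otimes> src u = \<zero>"
    obtain v where v: "v \<in> U" "v \<preceq> u" "v \<preceq> d"
      using uf_dir[OF U u d] by blast
    have "b \<otimes> src v \<preceq> b \<otimes> src u"
      using v u b UB by (intro mult_mono_left source_mono) auto
    then have "src v = \<zero>"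
      using * src_eq[OF v(1,3)] by (simp add: zero_proj)
    then show False
      using v UB uf_nonzero[OF U] by simp
  qed
  show bT: "b \<in> transport b U"
    unfolding transport_def using d b UB by (auto intro!: upcI[of "b \<otimes> src d"] leqI)
  have memI: "b \<otimes> src u \<in> transport b U" if "u \<in> U" for u
    unfolding transport_def using that b UB by (auto intro!: upcI[of "b \<otimes> src u"] simp: mult_closed)
  have proper: "proper (transport b U)"
    unfolding transport_def
  proof (rule proper_upc)
    fix x y
    assume "x \<in> (\<lambda>u. b \<otimes> src u) ` U" "y \<in> (\<lambda>u. b \<otimes> src u) ` U"
    then obtain u v where uv: "u \<in> U" "v \<in> U" "x = b \<otimes> src u" "y = b \<otimes> src v"
      by blast
    then obtain w where "w \<in> U" "w \<preceq> u" "w \<preceq> v"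
      using uf_dir[OF U] by blast
    then show "\<exists>c\<in>(\<lambda>u. b \<otimes> src u) ` U. c \<preceq> x \<and> c \<preceq> y"
      using uv b UB by (intro bexI[of _ "b \<otimes> src w"]) (auto intro!: mult_mono_left source_mono)
  next
    show "\<zero> \<notin> (\<lambda>u. b \<otimes> src u) ` U"
      using nonzero by force
  qed (use d b UB in \<open>auto simp: mult_closed\<close>)
  show "transport b U \<in> ultrafilters B"
  proof (rule ultrafilterI[OF proper])
    fix g
    assume g: "g \<in> carrier B" "g \<notin> transport b U"
    obtain h where h: "h \<preceq> g" "h \<preceq> b" "\<And>c. \<lbrakk>c \<preceq> g; c \<preceq> b\<rbrakk> \<Longrightarrow> c \<preceq> h"
      using ex_meet[OF g(1) b(1)] by metis
    have hB: "h \<in> carrier B"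
      using h(2) b(1) by (rule leq_carrier)
    \<comment> \<open>\<open>k\<close> is the counterpart below \<open>d\<close> of the part of
      \<open>h\<close> that lies over \<open>src d\<close>.\<close>
    define k where "k = d \<otimes> src h"
    have k: "k \<preceq> d" "k \<in> carrier B" "src k = src d \<otimes> src h"
      using d UB hB by (auto simp: k_def leqI mult_closed)
    have "k \<notin> U"
    proof
      assume "k \<in> U"
      have "b \<otimes> src k \<preceq> b \<otimes> src h"
        using b k hB d UB by (auto intro!: mult_mono_left simp: proj_mult_leq)
      also have "\<dots> = h"
        using h(2) b(1) by (rule mult_source_leq)
      also have "\<dots> \<preceq> g"
        by (rule h)
      finally have "g \<in> transport b U"
        using memI[OF \<open>k \<in> U\<close>] proper_up[OF proper] g(1) by blast
      then show False
        using g by simp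
    qed
    then obtain u where u: "u \<in> U" "u \<preceq> d" "orth u k"
      using ultrafilter_orth[OF U k(2) _ d] by blast
    \<comment> \<open>As \<open>src u \<preceq> src d\<close>, inserting \<open>src d\<close> turns
      \<open>src h\<close> into \<open>src k\<close>, and \<open>u\<close> is disjoint from
      \<open>k\<close> under the common bound \<open>d\<close>.\<close>
    have "src u \<otimes> src h = (src d \<otimes> src u) \<otimes> src h"
      using u d UB source_mono[of u d] proj_leq_iff by simp
    also have "\<dots> = src u \<otimes> src k"
      using u(1) d UB hB k(3) by (simp add: mult_assoc proj_comm[of "src d"])
    also have "\<dots> = \<zero>"
      using orth_source[OF u(2) k(1) _ u(3)] d UB by simp
    finally have *: "orth (b \<otimes> src u) h"
      using u src_eq b hB UB by (intro source_orth) (auto simp: mult_closed)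
    have "orth (b \<otimes> src u) g"
      unfolding orth_def
    proof (intro allI impI)
      fix c
      assume c: "c \<preceq> b \<otimes> src u" "c \<preceq> g"
      then have "c \<preceq> b"
        using leq_trans[OF c(1) leqI[of "src u" b]] u UB b by simp
      then show "c = \<zero>"
        using orthD[OF * c(1)] h(3)[OF c(2)] by simp
    qed
    then show "\<exists>w\<in>transport b U. orth w g"
      using memI u by blast
  qed
qed

section \<open>Sources and products of ultrafilters\<close>

lemma uf_source_eq_upc: "uf_source B U = upc (source B ` U)"
  by (auto simp: uf_source_def upc_def)

text \<open>The source is a proper filter containing the copy of \<open>U\<close> through
  \<open>src a\<close>, for any \<open>a \<in> U\<close>. That copy is an ultrafilter, so the two
  coincide.\<close>

lemma uf_source_ultrafilter:
  assumes U: "U \<in> ultrafilters B"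
  shows "uf_source B U \<in> ultrafilters B"
proof -
  have UB: "u \<in> carrier B" if "u \<in> U" for u
    using that U uf_carrier by blast
  obtain a where a: "a \<in> U"
    using proper_nonempty[OF ultrafilter_proper[OF U]] by blast
  have T: "transport (src a) U \<in> ultrafilters B"
    using transport_ultrafilter(1)[OF U a, of "src a"] UB a by simp
  have "proper (uf_source B U)"
    unfolding uf_source_eq_upc
  proof (rule proper_upc)
    fix x y
    assume "x \<in> source B ` U" "y \<in> source B ` U"
    then obtain u v where uv: "u \<in> U" "v \<in> U" "x = src u" "y = src v"
      by blast
    then obtain w where "w \<in> U" "w \<preceq> u" "w \<preceq> v"
      using uf_dir[OF U] by blast
    then show "\<exists>c\<in>source B ` U. c \<preceq> x \<and> c \<preceq> y"
      using uv UB by (intro bexI[of _ "src w"]) (auto intro!: source_mono)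
  next
    show "\<zero> \<notin> source B ` U"
      using UB uf_nonzero[OF U] source_eq_zero by (metis imageE)
  qed (use UB a in auto)
  moreover have "transport (src a) U \<subseteq> uf_source B U"
  proof
    fix c
    assume "c \<in> transport (src a) U"
    then obtain u where u: "u \<in> U" "src a \<otimes> src u \<preceq> c" and c: "c \<in> carrier B"
      by (auto simp: transport_def upc_def)
    obtain v where v: "v \<in> U" "v \<preceq> u" "v \<preceq> a"
      using uf_dir[OF U u(1) a] by blast
    have "src v = src a \<otimes> src v"
      using source_mono[OF v(3) UB[OF a]] proj_leq_iff UB v(1) a by simp
    also have "\<dots> \<preceq> src a \<otimes> src u"
      using mult_mono_left[OF source_mono[OF v(2) UB[OF u(1)]]] UB u(1) a by simp
    finally have "src v \<preceq> c"
      using u(2) c by (rule leq_trans)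
    then show "c \<in> uf_source B U"
      using v(1) c by (auto simp: uf_source_def)
  qed
  ultimately have "uf_source B U = transport (src a) U"
    using ultrafilter_eqI[OF T] by blast
  then show ?thesis
    using T by simp
qed

lemma source_mem_uf_source:
  assumes "U \<in> ultrafilters B" "a \<in> U"
  shows "src a \<in> uf_source B U"
  using assms uf_carrier[OF assms] by (auto simp: uf_source_def intro!: bexI[of _ a])

text \<open>Given \<open>c \<in> U\<close>, some \<open>d \<in> U\<close> lies below
  \<open>c\<close> and \<open>b\<close>. Equality of sources yields \<open>w \<in> V\<close> below
  \<open>b\<close> with \<open>src w \<preceq> src d\<close>, and restricting \<open>b\<close> to
  both sources gives \<open>w \<preceq> d \<preceq> c\<close>. Hence each basic set is a
  section.\<close>

lemma uf_source_determines:
  assumes U: "U \<in> ultrafilters B" "b \<in> U" and V: "V \<in> ultrafilters B" "b \<in> V"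
    and eq: "uf_source B U = uf_source B V"
  shows "U = V"
proof -
  have b: "b \<in> carrier B"
    using uf_carrier[OF U] .
  have "c \<in> V" if c: "c \<in> U" for c
  proof -
    have cB: "c \<in> carrier B"
      using uf_carrier[OF U(1) c] .
    obtain d where d: "d \<in> U" "d \<preceq> c" "d \<preceq> b"
      using uf_dir[OF U(1) c U(2)] by blast
    have dB: "d \<in> carrier B"
      using uf_carrier[OF U(1) d(1)] .
    obtain v where v: "v \<in> V" "src v \<preceq> src d"
      using source_mem_uf_source[OF U(1) d(1)] eq by (auto simp: uf_source_def)
    obtain w where w: "w \<in> V" "w \<preceq> v" "w \<preceq> b"
      using uf_dir[OF V(1) v(1) V(2)] by blast
    have vB: "v \<in> carrier B"
      using uf_carrier[OF V(1) v(1)] .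
    have "w = b \<otimes> src w"
      using mult_source_leq[OF w(3) b] by simp
    also have "\<dots> \<preceq> b \<otimes> src v"
      using source_mono[OF w(2) vB] vB b by (simp add: mult_mono_left)
    also have "\<dots> \<preceq> b \<otimes> src d"
      using v(2) dB b by (simp add: mult_mono_left)
    also have "\<dots> = d"
      using d(3) b by (rule mult_source_leq)
    also have "\<dots> \<preceq> c"
      by (rule d)
    finally show "c \<in> V"
      using uf_up[OF V(1) w(1)] cB b dB vB by (simp add: mult_closed)
  qed
  then show ?thesis
    using ultrafilter_eqI[OF U(1) ultrafilter_proper[OF V(1)]] by blast
qed

section \<open>Products and factorization of ultrafilters\<close>

lemma uf_prod_eq_upc: "uf_prod B V W = upc {v \<otimes> w |v w. v \<in> V \<and> w \<in> W}"
  unfolding uf_prod_def upc_def by blast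

lemma uf_prod_proper:
  assumes V: "proper V" and W: "proper W" and "uf_prod_defined B V W"
  shows "proper (uf_prod B V W)"
  unfolding uf_prod_eq_upc
proof (rule proper_upc)
  fix x y
  assume "x \<in> {v \<otimes> w |v w. v \<in> V \<and> w \<in> W}" "y \<in> {v \<otimes> w |v w. v \<in> V \<and> w \<in> W}"
  then obtain v w v' w' where vw: "v \<in> V" "w \<in> W" "x = v \<otimes> w" "v' \<in> V" "w' \<in> W" "y = v' \<otimes> w'"
    by blast
  obtain v'' where v'': "v'' \<in> V" "v'' \<preceq> v" "v'' \<preceq> v'"
    using proper_dir[OF V vw(1,4)] by blast
  obtain w'' where w'': "w'' \<in> W" "w'' \<preceq> w" "w'' \<preceq> w'"
    using proper_dir[OF W vw(2,5)] by blast
  have "v'' \<otimes> w'' \<preceq> x" "v'' \<otimes> w'' \<preceq> y"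
    using vw v'' w'' proper_carrier[OF V] proper_carrier[OF W] by (simp_all add: mult_mono)
  then show "\<exists>c\<in>{v \<otimes> w |v w. v \<in> V \<and> w \<in> W}. c \<preceq> x \<and> c \<preceq> y"
    using v''(1) w''(1) by blast
next
  show "{v \<otimes> w |v w. v \<in> V \<and> w \<in> W} \<noteq> {}"
    using proper_nonempty[OF V] proper_nonempty[OF W] by blast
next
  show "\<zero> \<notin> {v \<otimes> w |v w. v \<in> V \<and> w \<in> W}"
    using assms(3) by (simp only: uf_prod_defined_def not_False_eq_True)
qed (use proper_carrier[OF V] proper_carrier[OF W] in \<open>auto simp: mult_closed\<close>)

text \<open>For \<open>w \<preceq> b\<close> one has
  \<open>a \<otimes> w = a \<otimes> b \<otimes> src w\<close>, so the product contains the copy of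
  \<open>W\<close> through \<open>a \<otimes> b\<close>. Being a proper filter, it equals that
  ultrafilter.\<close>

lemma uf_prod_ultrafilter:
  assumes V: "V \<in> ultrafilters B" and W: "W \<in> ultrafilters B" and defd: "uf_prod_defined B V W"
    and a: "a \<in> V" and b: "b \<in> W"
  shows "uf_prod B V W \<in> ultrafilters B" "a \<otimes> b \<in> uf_prod B V W"
proof -
  have aB: "a \<in> carrier B"
    using uf_carrier[OF V a] .
  have WB: "w \<in> carrier B" if "w \<in> W" for w
    using that W uf_carrier by blast
  have nonzero: "v \<otimes> w \<noteq> \<zero>" if "v \<in> V" "w \<in> W" for v w
    using defd that unfolding uf_prod_defined_def by force
  have bB: "b \<in> carrier B" and abB: "a \<otimes> b \<in> carrier B"
    using WB[OF b] aB by (simp_all add: mult_closed)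
  have restr: "a \<otimes> b \<otimes> src w = a \<otimes> w" if "w \<in> W" "w \<preceq> b" for w
    using mult_source_leq[OF that(2) bB] WB[OF that(1)] aB bB by (simp add: mult_assoc)
  \<comment> \<open>Transport to \<open>a \<otimes> b\<close> needs an element of \<open>W\<close>
    with source below \<open>src (a \<otimes> b)\<close>; the restriction \<open>d\<close> of
    \<open>b\<close> has exactly this source.\<close>
  define d where "d = b \<otimes> src (a \<otimes> b)"
  have d: "d \<in> carrier B" "src d = src (a \<otimes> b)"
    using source_mult_leq[OF aB bB] bB abB proj_leq_iff by (simp_all add: d_def mult_closed)
  have "d \<in> W"
  proof (rule ccontr)
    assume "d \<notin> W"
    then obtain w where w: "w \<in> W" "w \<preceq> b" "orth w d"
      using ultrafilter_orth[OF W d(1) _ b] by metis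
    \<comment> \<open>If \<open>d\<close> were missing, some \<open>w \<preceq> b\<close> in
      \<open>W\<close> would have a source disjoint from \<open>src (a \<otimes> b)\<close>. Then
      \<open>a \<otimes> w\<close> would be zero, although the product is defined.\<close>
    have "src w \<otimes> src d = \<zero>"
      using orth_source[OF w(2) _ bB w(3)] leqI[of "src (a \<otimes> b)" b] abB by (simp add: d_def)
    then have "src (a \<otimes> b \<otimes> src w) = \<zero>"
      using d(2) abB WB[OF w(1)] proj_comm[of "src w" "src (a \<otimes> b)"] by simp
    then show False
      using nonzero[OF a w(1)] restr[OF w(1,2)] aB WB[OF w(1)] by (simp add: mult_closed)
  qed
  then have T: "transport (a \<otimes> b) W \<in> ultrafilters B" "a \<otimes> b \<in> transport (a \<otimes> b) W"
    using transport_ultrafilter[OF W _ abB, of d] d(2) abB by simp_all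
  have "transport (a \<otimes> b) W \<subseteq> uf_prod B V W"
  proof
    fix c
    assume "c \<in> transport (a \<otimes> b) W"
    then obtain w where w: "w \<in> W" "a \<otimes> b \<otimes> src w \<preceq> c" and c: "c \<in> carrier B"
      by (auto simp: transport_def upc_def)
    obtain w' where w': "w' \<in> W" "w' \<preceq> w" "w' \<preceq> b"
      using uf_dir[OF W w(1) b] by blast
    have "a \<otimes> b \<otimes> src w' \<preceq> a \<otimes> b \<otimes> src w"
      using source_mono[OF w'(2) WB[OF w(1)]] abB WB[OF w(1)] by (simp add: mult_mono_left)
    then have "a \<otimes> w' \<preceq> c"
      using leq_trans[OF _ w(2) c] restr[OF w'(1,3)] by simp
    then show "c \<in> uf_prod B V W"
      using a w'(1) c unfolding uf_prod_def by blast
  qed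
  then have "uf_prod B V W = transport (a \<otimes> b) W"
    using ultrafilter_eqI[OF T(1) uf_prod_proper[OF _ _ defd]] V W ultrafilter_proper by blast
  then show "uf_prod B V W \<in> ultrafilters B" "a \<otimes> b \<in> uf_prod B V W"
    using T by simp_all
qed

text \<open>Restricting \<open>p \<otimes> b\<close> to \<open>src w\<close> writes \<open>w\<close>
  as \<open>p \<otimes> c\<close>, and \<open>p\<close> is idempotent. In this way a left projection
  acts as a bound on a target.\<close>

lemma proj_mult_absorb:
  assumes "w \<preceq> p \<otimes> b" "p \<in> proj B" "b \<in> carrier B"
  shows "p \<otimes> w = w"
proof -
  have pb: "p \<otimes> b \<in> carrier B" and w: "w \<in> carrier B"
    using assms leq_carrier[OF assms(1)] by (simp_all add: mult_closed)
  define c where "c = b \<otimes> src w"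
  have c: "c \<in> carrier B" "p \<otimes> c = w"
    using mult_source_leq[OF assms(1) pb] assms(2,3) w
    by (simp_all add: c_def mult_closed mult_assoc)
  have "p \<otimes> (p \<otimes> c) = p \<otimes> c"
    using assms(2) c(1) mult_assoc[of p p c] by (simp add: proj_idem)
  then show ?thesis
    by (simp only: c(2))
qed

text \<open>Since a semicategory has no targets, a left factor cannot be read off as a target unit.
  Instead the projections \<open>p\<close> with \<open>p \<otimes> b \<in> W\<close> form an ultrafilter of projections, by right
  distributivity.\<close>

lemma left_factor_ultrafilter:
  assumes W: "W \<in> ultrafilters B" and a: "a \<in> carrier B" and b: "b \<in> carrier B"
    and ab: "src a \<otimes> b \<in> W"
  defines "V \<equiv> upc {a \<otimes> p |p. p \<in> proj B \<and> p \<otimes> b \<in> W}"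
  shows "V \<in> ultrafilters B" "a \<in> V"
proof -
  define F where "F = {p \<in> proj B. p \<otimes> b \<in> W}"
  have F_proj: "p \<in> proj B" if "p \<in> F" for p
    using that by (simp add: F_def)
  have V_eq: "V = upc ((\<otimes>) a ` F)"
    unfolding V_def F_def by (rule arg_cong[of _ _ upc]) blast
  have aF: "src a \<in> F"
    using a ab by (simp add: F_def)
  have F_mult: "p \<otimes> q \<in> F" if p: "p \<in> F" and q: "q \<in> F" for p q
  proof -
    have pq: "p \<in> proj B" "q \<in> proj B" "p \<otimes> b \<in> W" "q \<otimes> b \<in> W"
      using p q by (auto simp: F_def)
    \<comment> \<open>An element \<open>w\<close> below both products is fixed by \<open>p\<close>
      and by \<open>q\<close> from the left, so \<open>w = p \<otimes> q \<otimes> w \<preceq> p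
      \<otimes> q \<otimes> b\<close>.\<close>
    obtain w where w: "w \<in> W" "w \<preceq> p \<otimes> b" "w \<preceq> q \<otimes> b"
      using uf_dir[OF W pq(3,4)] by blast
    have "w \<preceq> b"
      using leq_trans[OF w(2) proj_mult_le] pq b by simp
    then have "p \<otimes> q \<otimes> w \<preceq> p \<otimes> q \<otimes> b"
      using pq b by (simp add: mult_mono_left mult_closed)
    moreover have "p \<otimes> q \<otimes> w = w"
      using proj_mult_absorb[OF w(2) pq(1) b] proj_mult_absorb[OF w(3) pq(2) b] pq
        uf_carrier[OF W w(1)] by (simp add: mult_assoc)
    ultimately have "p \<otimes> q \<otimes> b \<in> W"
      using uf_up[OF W w(1)] pq b by (simp add: mult_closed)
    then show ?thesis
      using pq by (simp add: F_def proj_closed)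
  qed
  have "\<zero> \<notin> F"
    using uf_nonzero[OF W] b by (simp add: F_def zero_mult)
  have memI: "a \<otimes> p \<in> V" if "p \<in> F" for p
    unfolding V_eq using that F_proj[OF that] a
    by (intro upcI[of "a \<otimes> p"]) (auto simp: mult_closed)
  show "a \<in> V"
    using memI[OF aF] a by simp
  have proper: "proper V"
    unfolding V_eq
  proof (rule proper_upc)
    show "\<zero> \<notin> (\<otimes>) a ` F"
    proof
      assume "\<zero> \<in> (\<otimes>) a ` F"
      then obtain p where p: "p \<in> F" "a \<otimes> p = \<zero>"
        by auto
      have "src a \<otimes> p = src (a \<otimes> p)"
        using a F_proj[OF p(1)] by simp
      also have "\<dots> = \<zero>"
        by (simp add: p(2))
      finally show False
        using F_mult[OF aF p(1)] \<open>\<zero> \<notin> F\<close> by simp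
    qed
  next
    fix x y
    assume "x \<in> (\<otimes>) a ` F" "y \<in> (\<otimes>) a ` F"
    then obtain p q where pq: "p \<in> F" "q \<in> F" "x = a \<otimes> p" "y = a \<otimes> q"
      by blast
    then have "a \<otimes> (p \<otimes> q) \<preceq> x" "a \<otimes> (p \<otimes> q) \<preceq> y"
      using F_proj proj_mult_leq[of p q] a by (simp_all add: mult_mono_left)
    then show "\<exists>c\<in>(\<otimes>) a ` F. c \<preceq> x \<and> c \<preceq> y"
      using F_mult[OF pq(1,2)] by blast
  qed (use a aF F_proj in \<open>auto simp: mult_closed\<close>)
  show "V \<in> ultrafilters B"
  proof (rule ultrafilterI[OF proper])
    fix g
    assume g: "g \<in> carrier B" "g \<notin> V"
    obtain h where h: "h \<preceq> g" "h \<preceq> a" "\<And>c. \<lbrakk>c \<preceq> g; c \<preceq> a\<rbrakk> \<Longrightarrow> c \<preceq> h"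
      using ex_meet[OF g(1) a] by metis
    have hB: "h \<in> carrier B"
      using h(2) a by (rule leq_carrier)
    have sh: "src h \<preceq> src a"
      using h(2) a by (rule source_mono)
    obtain q where q: "q \<preceq> src a" "orth (src h) q" "src h \<squnion>\<^bsub>rs_order B\<^esub> q = src a"
      using ex_complement[OF _ sh] a by (metis source_carrier)
    have qP: "q \<in> proj B"
      using leq_proj[OF q(1)] a by simp
    \<comment> \<open>The projections \<open>src h\<close> and \<open>q\<close> are complementary in
      \<open>src a\<close>, so right distributivity makes \<open>src a \<otimes> b\<close> the join
      of the two products, and primeness of \<open>W\<close> selects one of them.\<close>
    have "src h \<otimes> b \<in> W \<or> q \<otimes> b \<in> W"
    proof (rule ultrafilter_prime[OF W ab])
      show "src h \<otimes> b \<preceq> src a \<otimes> b" "q \<otimes> b \<preceq> src a \<otimes> b"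
        using sh q(1) a b by (simp_all add: mult_mono_right)
    next
      fix z
      assume "z \<in> carrier B" "src h \<otimes> b \<preceq> z" "q \<otimes> b \<preceq> z"
      then show "src a \<otimes> b \<preceq> z"
        using join_mult_least[OF _ sh q(1,3) b] a by simp
    qed
    \<comment> \<open>The first alternative would put \<open>a \<otimes> src h = h\<close> into
      \<open>V\<close>, and with it \<open>g\<close>.\<close>
    moreover have "src h \<otimes> b \<notin> W"
    proof
      assume "src h \<otimes> b \<in> W"
      then have "a \<otimes> src h \<in> V"
        using hB by (intro memI) (simp add: F_def)
      then show False
        using g proper_up[OF proper _ h(1)] mult_source_leq[OF h(2) a] by simp
    qed
    ultimately have qF: "q \<in> F"
      using qP by (simp add: F_def)
    have "src h \<otimes> q = \<zero>"
      using orth_source[OF sh q(1) _ q(2)] a hB qP by simp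
    then have "src (a \<otimes> q) \<otimes> src h = \<zero>"
      using a qP hB proj_comm[of q "src h"] by (simp add: mult_assoc)
    then have *: "orth (a \<otimes> q) h"
      using a qP hB by (intro source_orth) (simp_all add: mult_closed)
    have "orth (a \<otimes> q) g"
      unfolding orth_def
    proof (intro allI impI)
      fix c
      assume c: "c \<preceq> a \<otimes> q" "c \<preceq> g"
      then have "c \<preceq> a"
        using leq_trans[OF c(1) leqI[OF qP] a] by simp
      then show "c = \<zero>"
        using orthD[OF * c(1)] h(3)[OF c(2)] by simp
    qed
    then show "\<exists>w\<in>V. orth w g"
      using memI[OF qF] by blast
  qed
qed

text \<open>The factors are chosen so that every product \<open>v \<otimes> w\<close> lies in
  \<open>U\<close>. This excludes zero, so the product is defined; it is then an ultrafilter
  contained in \<open>U\<close>, hence equal to \<open>U\<close>.\<close>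

lemma ultrafilter_factor:
  assumes U: "U \<in> ultrafilters B" and a: "a \<in> carrier B" and b: "b \<in> carrier B"
    and ab: "a \<otimes> b \<in> U"
  obtains V W where "V \<in> ultrafilters B" "a \<in> V" "W \<in> ultrafilters B" "b \<in> W"
    "uf_prod_defined B V W" "uf_prod B V W = U"
proof -
  have UB: "u \<in> carrier B" if "u \<in> U" for u
    using that U uf_carrier by blast
  define W where "W = transport b U"
  have W: "W \<in> ultrafilters B" "b \<in> W"
    using transport_ultrafilter[OF U ab b source_mult_leq[OF a b]] by (simp_all add: W_def)
  have WB: "w \<in> carrier B" if "w \<in> W" for w
    using that W(1) uf_carrier by blast
  \<comment> \<open>The restriction of \<open>b\<close> to \<open>src (a \<otimes> b)\<close> is a
    generator of \<open>W\<close>; it equals \<open>src a \<otimes> b\<close> by the axiom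
    \<open>source_mult\<close>.\<close>
  have "src a \<otimes> b = b \<otimes> src (src a \<otimes> b)"
    using mult_source_leq[OF proj_mult_le[OF source_proj[OF a] b] b] by simp
  also have "\<dots> = b \<otimes> src (a \<otimes> b)"
    using source_mult[OF a b] by simp
  also have "\<dots> \<in> W"
    unfolding W_def transport_def using ab UB[OF ab] b
    by (intro upcI[of "b \<otimes> src (a \<otimes> b)"]) (simp_all add: mult_closed)
  finally have sab: "src a \<otimes> b \<in> W" .
  define V where "V = upc {a \<otimes> p |p. p \<in> proj B \<and> p \<otimes> b \<in> W}"
  have V: "V \<in> ultrafilters B" "a \<in> V"
    using left_factor_ultrafilter[OF W(1) a b sab] by (simp_all add: V_def)
  have prod: "v \<otimes> w \<in> U" if v: "v \<in> V" and w: "w \<in> W" for v w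
  proof -
    obtain p where p: "p \<in> proj B" "p \<otimes> b \<in> W" "a \<otimes> p \<preceq> v"
      using v by (auto simp: V_def upc_def)
    have vB: "v \<in> carrier B"
      using uf_carrier[OF V(1) v] .
    obtain w' where w': "w' \<in> W" "w' \<preceq> w" "w' \<preceq> p \<otimes> b"
      using uf_dir[OF W(1) w p(2)] by blast
    obtain u where u: "u \<in> U" "b \<otimes> src u \<preceq> w'"
      using w'(1) by (auto simp: W_def transport_def upc_def)
    obtain u' where u': "u' \<in> U" "u' \<preceq> u" "u' \<preceq> a \<otimes> b"
      using uf_dir[OF U u(1) ab] by blast
    have "u' = a \<otimes> b \<otimes> src u'"
      using mult_source_leq[OF u'(3)] a b by (simp add: mult_closed)
    also have "\<dots> = a \<otimes> (b \<otimes> src u')"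
      using a b UB[OF u'(1)] by (simp add: mult_assoc)
    also have "\<dots> \<preceq> a \<otimes> (b \<otimes> src u)"
      using source_mono[OF u'(2) UB[OF u(1)]] a b UB[OF u(1)]
      by (simp add: mult_mono_left mult_closed)
    also have "\<dots> \<preceq> a \<otimes> w'"
      using u(2) WB[OF w'(1)] a by (rule mult_mono_left)
    \<comment> \<open>Since \<open>w' \<preceq> p \<otimes> b\<close>, the projection
      \<open>p\<close> can be inserted, which replaces \<open>a\<close> by the generator
      \<open>a \<otimes> p\<close> below \<open>v\<close>.\<close>
    also have "a \<otimes> w' = a \<otimes> p \<otimes> w'"
      using proj_mult_absorb[OF w'(3) p(1) b] a p(1) WB[OF w'(1)] by (simp add: mult_assoc)
    also have "\<dots> \<preceq> v \<otimes> w"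
      using mult_mono[OF p(3) w'(2) vB WB[OF w]] .
    finally show ?thesis
      using uf_up[OF U u'(1)] a b vB WB[OF w] WB[OF w'(1)] UB[OF u(1)] p(1)
      by (simp add: mult_closed)
  qed
  have defd: "uf_prod_defined B V W"
    using prod uf_nonzero[OF U] unfolding uf_prod_defined_def by force
  have "uf_prod B V W \<subseteq> U"
    using prod uf_up[OF U] by (auto simp: uf_prod_def)
  then have "uf_prod B V W = U"
    using ultrafilter_eqI[OF uf_prod_ultrafilter(1)[OF V(1) W(1) defd V(2) W(2)]
        ultrafilter_proper[OF U]] by simp
  then show thesis
    using that[OF V W defd] by simp
qed

section \<open>Basic open sets\<close>

abbreviation basic :: "'a \<Rightarrow> 'a set set"
  where "basic b \<equiv> basic_set B b"

lemma basic_iff: "U \<in> basic b \<longleftrightarrow> U \<in> ultrafilters B \<and> b \<in> U"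
  by (simp add: basic_set_def)

text \<open>One inclusion is \<open>uf_prod_ultrafilter\<close>, the other is
  \<open>ultrafilter_factor\<close>.\<close>

lemma section_prod_basic:
  assumes "a \<in> carrier B" "b \<in> carrier B"
  shows "section_prod B (basic a) (basic b) = basic (a \<otimes> b)"
proof
  show "section_prod B (basic a) (basic b) \<subseteq> basic (a \<otimes> b)"
    using uf_prod_ultrafilter by (fastforce simp: section_prod_def basic_iff)
  show "basic (a \<otimes> b) \<subseteq> section_prod B (basic a) (basic b)"
  proof
    fix U
    assume "U \<in> basic (a \<otimes> b)"
    then obtain V W where "V \<in> basic a" "W \<in> basic b" "uf_prod_defined B V W" "uf_prod B V W = U"
      using ultrafilter_factor[OF _ assms, of U] by (metis basic_iff)
    then show "U \<in> section_prod B (basic a) (basic b)"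
      unfolding section_prod_def by blast
  qed
qed

text \<open>If \<open>a\<close> is not below \<open>b\<close>, the complement in \<open>a\<close> of
  their meet is nonzero. An ultrafilter through this complement contains \<open>a\<close> and cannot
  contain \<open>b\<close>.\<close>

lemma basic_subset_iff:
  assumes a: "a \<in> carrier B" and b: "b \<in> carrier B"
  shows "basic a \<subseteq> basic b \<longleftrightarrow> a \<preceq> b"
proof
  assume "a \<preceq> b"
  then show "basic a \<subseteq> basic b"
    using b uf_up by (auto simp: basic_iff)
next
  assume sub: "basic a \<subseteq> basic b"
  obtain m where m: "m \<preceq> a" "m \<preceq> b" "\<And>c. \<lbrakk>c \<preceq> a; c \<preceq> b\<rbrakk> \<Longrightarrow> c \<preceq> m"
    using ex_meet[OF a b] by metis
  obtain y where y: "y \<preceq> a" "orth m y" "y = \<zero> \<Longrightarrow> m = a"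
    using ex_complement[OF a m(1)] by metis
  show "a \<preceq> b"
  proof (rule ccontr)
    assume "\<not> a \<preceq> b"
    then have "y \<noteq> \<zero>"
      using m(2) y(3) by blast
    moreover have "y \<in> carrier B"
      using y(1) a by (rule leq_carrier)
    ultimately obtain U where U: "U \<in> ultrafilters B" "y \<in> U"
      using ultrafilter_containing by metis
    then have "U \<in> basic a"
      using uf_up[OF U y(1) a] by (simp add: basic_iff)
    then have "b \<in> U"
      using sub by (auto simp: basic_iff)
    then obtain c where c: "c \<in> U" "c \<preceq> y" "c \<preceq> b"
      using uf_dir[OF U] by blast
    then have "c \<preceq> m"
      using m(3) leq_trans[OF c(2) y(1) a] by blast
    then have "c = \<zero>"
      using orthD[OF y(2)] c(2) by blast
    then show False
      using c(1) uf_nonzero[OF U(1)] by simp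
  qed
qed

lemma inj_on_basic: "inj_on basic (carrier B)"
  using basic_subset_iff leq_antisym by (intro inj_onI) (metis subset_refl)

lemma basic_inter:
  assumes "a \<in> carrier B" "b \<in> carrier B"
  obtains m where "m \<in> carrier B" "basic a \<inter> basic b = basic m"
proof -
  obtain m where m: "m \<preceq> a" "m \<preceq> b" "\<And>c. \<lbrakk>c \<preceq> a; c \<preceq> b\<rbrakk> \<Longrightarrow> c \<preceq> m"
    using ex_meet[OF assms] by metis
  have mB: "m \<in> carrier B"
    using m(1) assms(1) by (rule leq_carrier)
  have "m \<in> U" if U: "U \<in> ultrafilters B" and "a \<in> U" "b \<in> U" for U
    using uf_dir[OF U that(2,3)] uf_up[OF U _ _ mB] m(3) by blast
  then have "basic a \<inter> basic b \<subseteq> basic m"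
    by (auto simp: basic_iff)
  moreover have "basic m \<subseteq> basic a \<inter> basic b"
    using basic_subset_iff mB m(1,2) assms by simp
  ultimately show thesis
    using that mB by blast
qed

text \<open>An ultrafilter \<open>W\<close> through \<open>src a\<close> is the source of its copy
  through \<open>a\<close>: that source contains \<open>W\<close>, and \<open>W\<close> is
  maximal.\<close>

lemma basic_source:
  assumes a: "a \<in> carrier B"
  shows "uf_source B ` basic a = basic (src a)"
proof
  show "uf_source B ` basic a \<subseteq> basic (src a)"
    using uf_source_ultrafilter source_mem_uf_source by (auto simp: basic_iff)
  show "basic (src a) \<subseteq> uf_source B ` basic a"
  proof
    fix W
    assume "W \<in> basic (src a)"
    then have W: "W \<in> ultrafilters B" "src a \<in> W"
      by (auto simp: basic_iff)
    define U where "U = transport a W"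
    have U: "U \<in> ultrafilters B" "a \<in> U"
      using transport_ultrafilter[OF W a] a by (simp_all add: U_def)
    have "W \<subseteq> uf_source B U"
    proof
      fix w
      assume w: "w \<in> W"
      obtain p where p: "p \<in> W" "p \<preceq> w" "p \<preceq> src a"
        using uf_dir[OF W(1) w W(2)] by blast
      have pP: "p \<in> proj B"
        using leq_proj[OF p(3)] a by simp
      then have "a \<otimes> p \<in> U"
        unfolding U_def transport_def using p(1) a
        by (intro upcI[OF imageI[OF p(1)]]) (simp_all add: mult_closed)
      moreover have "src (a \<otimes> p) \<preceq> w"
        using p(2,3) pP a proj_leq_iff by simp
      ultimately show "w \<in> uf_source B U"
        using uf_carrier[OF W(1) w] by (auto simp: uf_source_def)
    qed
    then have "uf_source B U = W"
      using ultrafilter_eqI[OF W(1) ultrafilter_proper] uf_source_ultrafilter U(1) by blast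
    then show "W \<in> uf_source B ` basic a"
      using U by (auto simp: basic_iff)
  qed
qed

lemma is_section_basic: "is_section B (basic b)"
  unfolding is_section_def
  by (auto simp: basic_iff intro!: inj_onI dest: uf_source_determines)

lemma basic_subset_units: "p \<in> proj B \<Longrightarrow> basic p \<subseteq> uf_units B"
  by (auto simp: basic_iff uf_units_def)

section \<open>The topology: basis and compactness\<close>

lemma openin_basic: "b \<in> carrier B \<Longrightarrow> openin (uf_topology B) (basic b)"
  unfolding uf_topology_def by (intro topology_generated_by_Basis) blast

text \<open>Basic sets are closed under binary intersection by \<open>basic_inter\<close>, so the
  generating subbasis is already a basis.\<close>

lemma openin_uf_topology_iff:
  "openin (uf_topology B) N \<longleftrightarrow> (\<forall>U\<in>N. \<exists>a\<in>carrier B. U \<in> basic a \<and> basic a \<subseteq> N)"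
proof
  assume "openin (uf_topology B) N"
  then have "generate_topology_on (basic ` carrier B) N"
    unfolding uf_topology_def by (rule openin_topology_generated_by)
  then show "\<forall>U\<in>N. \<exists>a\<in>carrier B. U \<in> basic a \<and> basic a \<subseteq> N"
  proof induction
    case (Int M N)
    show ?case
    proof
      fix U
      assume "U \<in> M \<inter> N"
      then obtain a b where ab: "a \<in> carrier B" "U \<in> basic a" "basic a \<subseteq> M"
        "b \<in> carrier B" "U \<in> basic b" "basic b \<subseteq> N"
        using Int.IH by (metis IntE)
      then obtain m where "m \<in> carrier B" "basic a \<inter> basic b = basic m"
        using basic_inter by metis
      then show "\<exists>a\<in>carrier B. U \<in> basic a \<and> basic a \<subseteq> M \<inter> N"
        using ab by blast
    qed
  next
    case (UN K)
    then show ?case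
      by (metis UnionE Union_upper subset_trans)
  qed blast+
next
  assume *: "\<forall>U\<in>N. \<exists>a\<in>carrier B. U \<in> basic a \<and> basic a \<subseteq> N"
  then have "N = \<Union>{basic a |a. a \<in> carrier B \<and> basic a \<subseteq> N}"
    by blast
  moreover have "openin (uf_topology B) (\<Union>{basic a |a. a \<in> carrier B \<and> basic a \<subseteq> N})"
    using openin_basic by (intro openin_Union) blast
  ultimately show "openin (uf_topology B) N"
    by simp
qed

lemma basic_is_basis: "is_basis_of (basic ` carrier B) (uf_topology B)"
  unfolding is_basis_of_def
  by (rule ext) (auto simp: openin_uf_topology_iff arbitrary_union_of_alt)

text \<open>If no finite subfamily covers, then the \<open>c\<close> for which \<open>basic c\<close> together with a finite
  subfamily covers form a proper filter; an ultrafilter extending it is not covered at all.\<close>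

lemma basic_finite_subcover:
  assumes b: "b \<in> carrier B" and A: "A \<subseteq> carrier B" and cover: "basic b \<subseteq> \<Union>(basic ` A)"
  obtains F where "finite F" "F \<subseteq> A" "basic b \<subseteq> \<Union>(basic ` F)"
proof (rule ccontr)
  assume "\<not> thesis"
  then have no: "\<not> basic b \<subseteq> \<Union>(basic ` F)" if "finite F" "F \<subseteq> A" for F
    using that by (metis \<open>\<And>F. \<lbrakk>finite F; F \<subseteq> A; basic b \<subseteq> \<Union>(basic ` F)\<rbrakk> \<Longrightarrow> thesis\<close>)
  define G where
    "G = {c \<in> carrier B. \<exists>F. finite F \<and> F \<subseteq> A \<and> basic b \<subseteq> basic c \<union> \<Union>(basic ` F)}"
  have "proper G"
    unfolding proper_iff
  proof (intro conjI ballI impI)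
    show "G \<subseteq> carrier B"
      by (auto simp: G_def)
    show "G \<noteq> {}"
      using b by (auto simp: G_def)
  next
    fix x y
    assume x: "x \<in> G" and y: "y \<in> carrier B" "x \<preceq> y"
    have "basic x \<subseteq> basic y"
      using x y by (simp add: G_def basic_subset_iff)
    then show "y \<in> G"
      using x y(1) unfolding G_def by blast
  next
    fix x y
    assume "x \<in> G" "y \<in> G"
    then obtain F H where xy: "x \<in> carrier B" "y \<in> carrier B"
      and F: "finite F" "F \<subseteq> A" "basic b \<subseteq> basic x \<union> \<Union>(basic ` F)"
      and H: "finite H" "H \<subseteq> A" "basic b \<subseteq> basic y \<union> \<Union>(basic ` H)"
      by (auto simp: G_def)
    obtain m where m: "m \<in> carrier B" "basic x \<inter> basic y = basic m"
      using basic_inter[OF xy] by metis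
    have "basic b \<subseteq> (basic x \<inter> basic y) \<union> \<Union>(basic ` (F \<union> H))"
      using F(3) H(3) by blast
    then have "m \<in> G"
      using m F(1,2) H(1,2) by (auto simp: G_def intro!: exI[of _ "F \<union> H"])
    moreover have "m \<preceq> x" "m \<preceq> y"
      using basic_subset_iff[OF m(1) xy(1)] basic_subset_iff[OF m(1) xy(2)] m(2) by blast+
    ultimately show "\<exists>c\<in>G. c \<preceq> x \<and> c \<preceq> y"
      by blast
  next
    have "basic \<zero> = {}"
      using uf_nonzero by (auto simp: basic_iff)
    then show "\<zero> \<notin> G"
      using no by (simp add: G_def)
  qed
  then obtain U where U: "U \<in> ultrafilters B" "G \<subseteq> U"
    using ultrafilter_extend by metis
  have "b \<in> G"
    using b by (auto simp: G_def)
  then have bU: "b \<in> U"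
    using U(2) by blast
  then obtain a where a: "a \<in> A" "a \<in> U"
    using cover U(1) by (auto simp: basic_iff)
  obtain m where m: "m \<in> carrier B" "basic a \<inter> basic b = basic m"
    using basic_inter a(1) A b by (metis subsetD)
  have mb: "m \<preceq> b"
    using basic_subset_iff[OF m(1) b] m(2) by blast
  \<comment> \<open>\<open>y\<close> is the complement in \<open>b\<close> of the element
    \<open>m\<close> representing \<open>basic a \<inter> basic b\<close>, so \<open>basic y\<close>
    and \<open>basic a\<close> together cover \<open>basic b\<close>. This forces \<open>y\<close>
    into \<open>G\<close> and hence into \<open>U\<close>, although \<open>m \<in> U\<close> is
    disjoint from it.\<close>
  obtain y where y: "y \<preceq> b" "orth m y" "\<And>u. \<lbrakk>u \<preceq> b; orth u m\<rbrakk> \<Longrightarrow> u \<preceq> y"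
    using ex_complement[OF b mb] by metis
  have yB: "y \<in> carrier B"
    using y(1) b by (rule leq_carrier)
  have "V \<in> basic y \<union> basic a" if V: "V \<in> basic b" for V
  proof (cases "m \<in> V")
    case True
    then show ?thesis
      using V m(2) by (auto simp: basic_iff)
  next
    case False
    have V': "V \<in> ultrafilters B" "b \<in> V"
      using V by (auto simp: basic_iff)
    then obtain u where "u \<in> V" "u \<preceq> b" "orth u m"
      using ultrafilter_orth[OF V'(1) m(1) False V'(2)] by metis
    then show ?thesis
      using y(3) uf_up[OF V'(1) _ _ yB] V'(1) by (simp add: basic_iff)
  qed
  then have "y \<in> G"
    using yB a(1) by (auto simp: G_def intro!: exI[of _ "{a}"])
  moreover have "m \<in> U"
    using m(2) a(2) bU U(1) by (auto simp: basic_iff)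
  ultimately obtain c where "c \<in> U" "c \<preceq> m" "c \<preceq> y"
    using uf_dir[OF U(1)] U(2) by blast
  then show False
    using orthD[OF y(2)] uf_nonzero[OF U(1)] by blast
qed

text \<open>An open cover is refined by the basic sets contained in its members. A finite subcover
  of the refinement then yields one of the original by choosing a member around each basic
  set.\<close>

lemma compactin_basic:
  assumes b: "b \<in> carrier B"
  shows "compactin (uf_topology B) (basic b)"
  unfolding compactin_def
proof (intro conjI allI impI)
  show "basic b \<subseteq> topspace (uf_topology B)"
    by (auto simp: topspace_uf_topology basic_iff)
next
  fix \<U>
  assume *: "(\<forall>N\<in>\<U>. openin (uf_topology B) N) \<and> basic b \<subseteq> \<Union>\<U>"
  define A where "A = {a \<in> carrier B. \<exists>N\<in>\<U>. basic a \<subseteq> N}"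
  have "basic b \<subseteq> \<Union>(basic ` A)"
  proof
    fix U
    assume "U \<in> basic b"
    then obtain N where "N \<in> \<U>" "U \<in> N"
      using * by blast
    then obtain a where "a \<in> carrier B" "U \<in> basic a" "basic a \<subseteq> N"
      using * openin_uf_topology_iff by metis
    then show "U \<in> \<Union>(basic ` A)"
      using \<open>N \<in> \<U>\<close> by (auto simp: A_def)
  qed
  moreover have "A \<subseteq> carrier B"
    by (auto simp: A_def)
  ultimately obtain F where F: "finite F" "F \<subseteq> A" "basic b \<subseteq> \<Union>(basic ` F)"
    using basic_finite_subcover[OF b] by metis
  have "\<forall>a\<in>F. \<exists>N. N \<in> \<U> \<and> basic a \<subseteq> N"
    using F(2) by (auto simp: A_def)
  then obtain f where f: "\<forall>a\<in>F. f a \<in> \<U> \<and> basic a \<subseteq> f a"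
    using bchoice[of F "\<lambda>a N. N \<in> \<U> \<and> basic a \<subseteq> N"] by blast
  have "\<Union>(basic ` F) \<subseteq> \<Union>(f ` F)"
    using f by (intro UN_mono) simp_all
  with F(3) have "basic b \<subseteq> \<Union>(f ` F)"
    by (rule subset_trans)
  then show "\<exists>\<F>. finite \<F> \<and> \<F> \<subseteq> \<U> \<and> basic b \<subseteq> \<Union>\<F>"
    using F(1) f by (intro exI[of _ "f ` F"] conjI) auto
qed

lemma basic_sections_simps [simp]:
  "carrier (basic_sections B) = basic ` carrier B"
  "proj (basic_sections B) = basic ` proj B"
  "mult (basic_sections B) = section_prod B"
  by (simp_all add: basic_sections_def compact_open_sections_def)

sublocale copy: restriction_semigroup_copy B "basic_sections B" "basic_set B"
  by standard (simp_all add: inj_on_basic section_prod_basic)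

end

text \<open>Order and source in \<open>basic_sections B\<close> are formed with its own projections
  only. The last two conjuncts identify them with inclusion and the image under
  \<open>uf_source B\<close>, so the structure agrees with the intended one on sections.\<close>

theorem theorem6p6:
  fixes B :: "('a, 'm) zpsemigroup_scheme"
  assumes "semi_boolean_restriction_semigroup B"
  shows "restriction_semigroup (basic_sections B)
    \<and> restriction_iso B (basic_sections B) (basic_set B)
    \<and> carrier (basic_sections B) \<subseteq> carrier (compact_open_sections B)
    \<and> proj (basic_sections B) \<subseteq> proj (compact_open_sections B)
    \<and> is_basis_of (carrier (basic_sections B)) (uf_topology B)
    \<and> (\<forall>M\<in>carrier (basic_sections B). \<forall>N\<in>carrier (basic_sections B).
         rs_le (basic_sections B) M N \<longleftrightarrow> M \<subseteq> N)
    \<and> (\<forall>N\<in>carrier (basic_sections B). source (basic_sections B) N = uf_source B ` N)"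
proof -
  interpret semi_boolean_restriction_semigroup B
    by (rule assms)
  have "restriction_iso B (basic_sections B) (basic_set B)"
    unfolding restriction_iso_def bij_betw_def
    by (simp add: inj_on_basic section_prod_basic copy.source_C)
  moreover have "carrier (basic_sections B) \<subseteq> carrier (compact_open_sections B)"
    "proj (basic_sections B) \<subseteq> proj (compact_open_sections B)"
    using compactin_basic openin_basic is_section_basic basic_subset_units[THEN subsetD]
    by (auto simp: compact_open_sections_def is_compact_open_def)
  moreover have "\<forall>M\<in>carrier (basic_sections B). \<forall>N\<in>carrier (basic_sections B).
      rs_le (basic_sections B) M N \<longleftrightarrow> M \<subseteq> N"
    by (auto simp: copy.le_C_iff basic_subset_iff)
  moreover have "\<forall>N\<in>carrier (basic_sections B). source (basic_sections B) N = uf_source B ` N"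
    by (simp add: copy.source_C basic_source)
  ultimately show ?thesis
    using copy.restriction_semigroup_C basic_is_basis by simp
qed

end
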